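(* Let $\lambda$ be a $k$-small partition, $\lambda\neq\varnothing$, and put $l=n-\lambda'_1+1$ and $r=\lambda_1$ (so $r<l$). Let $M_\lambda$ be the square matrix of size $n-l+1+r$, with rows indexed by $l,\dots,n$ followed by $1^\dagger,\dots,r^\dagger$ and columns indexed by $l,l+1,\dots,n+r$, defined by: the entry in row $p\in[l,n]$ and column $q$ is $z_{pq}$ (with $z_{pq}=0$ for $q<p$); the entry in row $s^\dagger$ ($1\le s\le r$) and column $q$ is $(-1)^m f_m^{\langle m,s\rangle;\lambda}$ if $q=n+s-m$ with $0\le m\le\lambda'_s$ (where $f_0^{\langle 0,s\rangle;\lambda}:=1$), and $0$ otherwise. Then $$\tilde g^{(k)}_\lambda(y|b)=\frac{\det M_\lambda}{\xi_\lambda(y)},\qquad \xi_\lambda(y)=\prod_{i=1}^{\lambda'_1}\Omega(b_{1-i}|y).$$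
   Context: Fix $n\ge2$, $k=n-1$. Let $R(T)=\mathbb{Z}[e^{\pm a_1},\dots,e^{\pm a_n}]/(e^{a_1+\cdots+a_n}-1)$; subscripts of $a_i,b_i$ are taken modulo $n$ with representatives in $\{1,\dots,n\}$; $b_i=1-e^{-a_i}$. Let $\hat\Lambda$ be the ring of symmetric formal power series in $y=(y_1,y_2,\dots)$ with coefficients in the fraction field of $R(T)$, and $\Omega(b_i|y)=\prod_{j\ge1}(1-b_iy_j)^{-1}$. For $1\le i\le n-1$, $s_i$ acts on $\hat\Lambda$ by exchanging $a_i,a_{i+1}$ in the coefficients; $s_\theta$ exchanges $a_1,a_n$; $s_0(f)=\frac{\Omega(b_1|y)}{\Omega(b_n|y)}s_\theta(f)$. Put $\alpha_i=a_i-a_{i+1}$ ($1\le i\le n-1$), $\alpha_0=a_n-a_1$, $T_i=(1-e^{\alpha_i})^{-1}(s_i-1)$, $D_i=T_i+1$; $D_x$ is defined via reduced words in the affine symmetric group $\hat W=\langle s_0,\dots,s_{n-1}\rangle$, and $\tilde g^{(k)}_x(y|b)=D_x(1)$ for $x$ in the set $\hat W^0$ of minimal-length representatives of $\hat W/S_n$. The $n$-residue of the box in row $r$, column $c$ of a Young diagram is $c-r\bmod n$. A partition $\lambda$ is $k$-small if $\lambda_1+\ell(\lambda)\le n$; then $\lambda$ corresponds to $x_\lambda\in\hat W^0$ obtained by adding the boxes of $\lambda$ one at a time (each new diagram a partition), a box of residue $i$ contributing a left factor $s_i$; $\tilde g^{(k)}_\lambda=\tilde g^{(k)}_{x_\lambda}$.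 For a box $(i,j)\in\lambda$ put $\mathfrak d(i,j)=\{e^{-a_{j-s}}: i\le s\le\lambda'_j\}$ and $f_m^{\langle i,j\rangle;\lambda}=h_m(\mathfrak d(i,j))$ (complete homogeneous symmetric polynomial). The elements $z_{pq}$ ($1\le p\le q\le p+n-1$) are defined by $z_{pp}=\Omega(b_p|y)$ and recursively $z_{pq}=\frac{z_{p,q-1}-z_{p+1,q}}{e^{-a_q}-e^{-a_p}}$ for $p<q$ (subscripts of $a$, $b$ mod $n$). *)

theory Defs
  imports "HOL-Library.Poly_Mapping" "HOL-Computational_Algebra.Fraction_Field"
          "HOL-Combinatorics.Permutations" "HOL-Library.FuncSet"
begin

text \<open>Laurent polynomials in countably many variables X_0, X_1, ... over the integers.
  R(T) = Z[e^{+-a_1},...,e^{+-a_n}]/(e^{a_1+...+a_n}-1) is identified with the Laurent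
  polynomial ring in X_1,...,X_{n-1} via e^{a_j} = X_j (1 <= j < n) and
  e^{a_n} = (X_1 ... X_{n-1})^{-1}.  Its fraction field is a subfield of K below.\<close>

type_synonym lexp = "nat \<Rightarrow>\<^sub>0 int"
type_synonym lpoly = "lexp \<Rightarrow>\<^sub>0 int"
type_synonym K = "lpoly fract"

definition Xv :: "nat \<Rightarrow> K" where
  "Xv j = Fract (Poly_Mapping.single (Poly_Mapping.single j 1) 1) 1"

definition idx :: "nat \<Rightarrow> int \<Rightarrow> nat" where
  "idx n i = nat ((i - 1) mod int n) + 1"

definition ea :: "nat \<Rightarrow> int \<Rightarrow> K" where
  "ea n i = (let j = idx n i in if j < n then Xv j else inverse (\<Prod>t\<in>{1..<n}. Xv t))"

definition bb :: "nat \<Rightarrow> int \<Rightarrow> K" where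
  "bb n i = 1 - inverse (ea n i)"

definition lpoly_eval :: "(nat \<Rightarrow> K) \<Rightarrow> lpoly \<Rightarrow> K" where
  "lpoly_eval v p = (\<Sum>mu \<in> Poly_Mapping.keys p.
      of_int (Poly_Mapping.lookup p mu) *
      (\<Prod>j \<in> Poly_Mapping.keys (mu :: lexp). power_int (v j) (Poly_Mapping.lookup mu j)))"

definition kmap :: "(nat \<Rightarrow> K) \<Rightarrow> K \<Rightarrow> K" where
  "kmap v x = (case (SOME pq. snd pq \<noteq> 0 \<and> x = Fract (fst pq) (snd pq)) of
                 (p, q) \<Rightarrow> lpoly_eval v p / lpoly_eval v q)"

definition kperm :: "nat \<Rightarrow> (nat \<Rightarrow> nat) \<Rightarrow> K \<Rightarrow> K" where
  "kperm n \<pi> = kmap (\<lambda>j. if 1 \<le> j \<and> j < n then ea n (int (\<pi> j)) else Xv j)"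

definition swapf :: "nat \<Rightarrow> nat \<Rightarrow> nat \<Rightarrow> nat" where
  "swapf i j = (\<lambda>t. if t = i then j else if t = j then i else t)"

text \<open>A formal power series is given by its coefficient at each monomial y^alpha
  (alpha a finitely supported exponent vector).  Lambda-hat is the subring of
  symmetric ones.\<close>

type_synonym ps = "(nat \<Rightarrow>\<^sub>0 nat) \<Rightarrow> K"

definition ps_const :: "K \<Rightarrow> ps" where
  "ps_const c = (\<lambda>\<alpha>. if \<alpha> = 0 then c else 0)"

definition ps_one :: ps where "ps_one = ps_const 1"

definition ps_add :: "ps \<Rightarrow> ps \<Rightarrow> ps" where
  "ps_add f g = (\<lambda>\<alpha>. f \<alpha> + g \<alpha>)"

definition ps_diff :: "ps \<Rightarrow> ps \<Rightarrow> ps" where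
  "ps_diff f g = (\<lambda>\<alpha>. f \<alpha> - g \<alpha>)"

definition ps_smult :: "K \<Rightarrow> ps \<Rightarrow> ps" where
  "ps_smult c f = (\<lambda>\<alpha>. c * f \<alpha>)"

definition ps_mult :: "ps \<Rightarrow> ps \<Rightarrow> ps" where
  "ps_mult f g = (\<lambda>\<alpha>. \<Sum>(\<beta>, \<gamma>)\<in>{(\<beta>, \<gamma>). \<beta> + \<gamma> = \<alpha>}. f \<beta> * g \<gamma>)"

definition ps_inv :: "ps \<Rightarrow> ps" where
  "ps_inv f = (THE g. ps_mult g f = ps_one)"

definition ps_prodl :: "ps list \<Rightarrow> ps" where
  "ps_prodl xs = foldr ps_mult xs ps_one"

text \<open>Omega(b|y) = prod_j (1 - b y_j)^{-1}: coefficient of y^alpha is b^{|alpha|}\<close>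
definition Omega :: "K \<Rightarrow> ps" where
  "Omega b = (\<lambda>\<alpha>. b ^ (\<Sum>j\<in>Poly_Mapping.keys \<alpha>. Poly_Mapping.lookup \<alpha> j))"

definition ps_perm :: "nat \<Rightarrow> (nat \<Rightarrow> nat) \<Rightarrow> ps \<Rightarrow> ps" where
  "ps_perm n \<pi> f = (\<lambda>\<alpha>. kperm n \<pi> (f \<alpha>))"

definition ps_det :: "nat \<Rightarrow> (nat \<Rightarrow> nat \<Rightarrow> ps) \<Rightarrow> ps" where
  "ps_det N M = (\<lambda>\<alpha>. \<Sum>\<sigma>\<in>{\<sigma>. \<sigma> permutes {0..<N}}.
       of_int (sign \<sigma>) * ps_prodl (map (\<lambda>i. M i (\<sigma> i)) [0..<N]) \<alpha>)"

definition s_op :: "nat \<Rightarrow> nat \<Rightarrow> ps \<Rightarrow> ps" where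
  "s_op n i f = (if i = 0
      then ps_mult (ps_mult (Omega (bb n 1)) (ps_inv (Omega (bb n (int n))))) (ps_perm n (swapf 1 n) f)
      else ps_perm n (swapf i (i + 1)) f)"

definition ealpha :: "nat \<Rightarrow> nat \<Rightarrow> K" where
  "ealpha n i = (if i = 0 then ea n (int n) * inverse (ea n 1)
                 else ea n (int i) * inverse (ea n (int i + 1)))"

definition T_op :: "nat \<Rightarrow> nat \<Rightarrow> ps \<Rightarrow> ps" where
  "T_op n i f = ps_smult (inverse (1 - ealpha n i)) (ps_diff (s_op n i f) f)"

definition D_op :: "nat \<Rightarrow> nat \<Rightarrow> ps \<Rightarrow> ps" where
  "D_op n i f = ps_add (T_op n i f) f"

definition D_word :: "nat \<Rightarrow> nat list \<Rightarrow> ps \<Rightarrow> ps" where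
  "D_word n w f = foldr (D_op n) w f"

definition aff_s :: "nat \<Rightarrow> nat \<Rightarrow> int \<Rightarrow> int" where
  "aff_s n i = (\<lambda>m. if m mod int n = int i then m + 1
                    else if m mod int n = (int i + 1) mod int n then m - 1 else m)"

definition aff_word :: "nat \<Rightarrow> nat list \<Rightarrow> int \<Rightarrow> int" where
  "aff_word n w = foldr (\<lambda>i g. aff_s n i \<circ> g) w id"

definition reduced_word :: "nat \<Rightarrow> nat list \<Rightarrow> bool" where
  "reduced_word n w \<longleftrightarrow> set w \<subseteq> {0..<n} \<and>
     (\<forall>w'. set w' \<subseteq> {0..<n} \<and> aff_word n w' = aff_word n w \<longrightarrow> length w \<le> length w')"

definition D_elem :: "nat \<Rightarrow> (int \<Rightarrow> int) \<Rightarrow> ps \<Rightarrow> ps" where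
  "D_elem n x = D_word n (SOME w. reduced_word n w \<and> aff_word n w = x)"

definition g_tilde_elem :: "nat \<Rightarrow> (int \<Rightarrow> int) \<Rightarrow> ps" where
  "g_tilde_elem n x = D_elem n x ps_one"

text \<open>A partition is a weakly decreasing list of positive naturals; lam ! (i-1) = lambda_i.\<close>
definition is_partition :: "nat list \<Rightarrow> bool" where
  "is_partition lam \<longleftrightarrow> (\<forall>x\<in>set lam. 0 < x) \<and> sorted_wrt (\<ge>) lam"

definition k_small :: "nat \<Rightarrow> nat list \<Rightarrow> bool" where
  "k_small n lam \<longleftrightarrow> (if lam = [] then 0 else hd lam) + length lam \<le> n"

definition conj :: "nat list \<Rightarrow> nat \<Rightarrow> nat" where
  "conj lam j = length (filter (\<lambda>x. j \<le> x) lam)"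

text \<open>residues of the boxes, added one at a time in row reading order
  (row 1 left to right, then row 2, ...); each box of residue i contributes a
  left factor s_i, so the word (leftmost letter first) is the reversed list\<close>
definition box_word :: "nat \<Rightarrow> nat list \<Rightarrow> nat list" where
  "box_word n lam = rev (concat (map (\<lambda>rr. map (\<lambda>c. nat ((int c - int rr) mod int n))
                                           [1..<lam ! (rr - 1) + 1]) [1..<length lam + 1]))"

definition x_lambda :: "nat \<Rightarrow> nat list \<Rightarrow> int \<Rightarrow> int" where
  "x_lambda n lam = aff_word n (box_word n lam)"

definition g_tilde :: "nat \<Rightarrow> nat list \<Rightarrow> ps" where
  "g_tilde n lam = g_tilde_elem n (x_lambda n lam)"

text \<open>zz n p d = z_{p,p+d}\<close>
fun zz :: "nat \<Rightarrow> nat \<Rightarrow> nat \<Rightarrow> ps" where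
  "zz n p 0 = Omega (bb n (int p))"
| "zz n p (Suc d) = ps_smult (inverse (inverse (ea n (int (p + Suc d))) - inverse (ea n (int p))))
                       (ps_diff (zz n p d) (zz n (Suc p) d))"

definition z_ent :: "nat \<Rightarrow> nat \<Rightarrow> nat \<Rightarrow> ps" where
  "z_ent n p q = (if q < p then ps_const 0 else zz n p (q - p))"

definition hset :: "nat \<Rightarrow> K set \<Rightarrow> K" where
  "hset m S = (\<Sum>\<alpha>\<in>{\<alpha>. \<alpha> \<in> S \<rightarrow>\<^sub>E {0..m} \<and> sum \<alpha> S = m}. \<Prod>x\<in>S. x ^ \<alpha> x)"

definition dset :: "nat \<Rightarrow> nat list \<Rightarrow> nat \<Rightarrow> nat \<Rightarrow> K set" where
  "dset n lam i j = {inverse (ea n (int j - int s)) | s. i \<le> s \<and> s \<le> conj lam j}"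

definition f_coef :: "nat \<Rightarrow> nat list \<Rightarrow> nat \<Rightarrow> nat \<Rightarrow> nat \<Rightarrow> K" where
  "f_coef n lam m i j = hset m (dset n lam i j)"

text \<open>Rows 0..n-l are the rows l..n, rows n-l+1..n-l+r are 1^dagger..r^dagger;
  column index j stands for column l + j.\<close>
definition M_lam :: "nat \<Rightarrow> nat list \<Rightarrow> nat \<Rightarrow> nat \<Rightarrow> ps" where
  "M_lam n lam i j = (let l = n - conj lam 1 + 1; q = l + j in
     if i < n - l + 1 then z_ent n (l + i) q
     else (let s = i - (n - l + 1) + 1 in
       if q \<le> n + s \<and> n + s - q \<le> conj lam s
       then (let m = n + s - q in ps_const ((-1) ^ m * (if m = 0 then 1 else f_coef n lam m m s)))
       else ps_const 0))"

definition xi :: "nat \<Rightarrow> nat list \<Rightarrow> ps" where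
  "xi n lam = ps_prodl (map (\<lambda>i. Omega (bb n (1 - int i))) [1..<conj lam 1 + 1])"

end

theory Submission
  imports Defs "Jordan_Normal_Form.Determinant"
begin

text \<open>
  Let \<open>L = \<lambda>'\<^sub>1\<close>, \<open>r = \<lambda>\<^sub>1\<close>. The residues of the boxes of \<open>\<lambda>\<close> only involve the \<open>L + r \<le> n\<close>
  consecutive integer positions \<open>1 - L, \<dots>, r\<close>. Multiplying by \<open>\<xi>\<close> absorbs the twist in \<open>s\<^sub>0\<close>, so
  that on this window every \<open>s\<^sub>i\<close> becomes a plain exchange of two adjacent variables
  \<open>u\<^sub>j = e\<^bsup>-a\<^esup>\<close>. The \<open>z\<close> entries are divided differences of \<open>x \<mapsto> \<Omega>(1 - x)\<close> up to sign, hence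
  symmetric in their nodes. Applying \<open>s\<^sub>i\<close> to the matrix of a partition therefore amounts to
  one column operation, one row operation and a change of the single daggered row of the column where
  a box of residue \<open>i\<close> can be added; expanding along this row shows that \<open>D\<^sub>i\<close> turns the
  determinant of a partition into that of the partition with the box added, for every addable box.
  Since a reduced word of \<open>x\<^sub>\<lambda>\<close> is not specified, one also needs that the first letter of any
  shortest word removes a box; this follows from the change of the number of inversions under \<open>s\<^sub>i\<close>,
  expressed through the charge vector of the coset.
\<close>

section \<open>The ring of power series\<close>

text \<open>A type of its own lets the series carry the convolution product as the multiplication of
  a \<open>comm_ring_1\<close>, so that the general theory of sums, products and determinants
  applies.\<close>

typedef mps = "UNIV :: ps set" morphisms coeffs Mps ..

lemmas [simp] = Mps_inverse[OF UNIV_I] coeffs_inverse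

lemma mps_eqI: "(\<And>\<alpha>. coeffs f \<alpha> = coeffs g \<alpha>) \<Longrightarrow> f = g"
  by (rule coeffs_inject[THEN iffD1], rule ext)

text \<open>The left summand is bounded by \<open>\<alpha>\<close> in every coordinate and
  determines the right one, so the splittings inject into a finite set of functions.\<close>

lemma finite_splits:
  fixes \<alpha> :: "nat \<Rightarrow>\<^sub>0 nat"
  shows "finite {(\<beta>, \<gamma>). \<beta> + \<gamma> = \<alpha>}"
proof -
  let ?S = "{(\<beta>, \<gamma>). \<beta> + \<gamma> = \<alpha>}"
  define b where "b = (\<Sum>j\<in>Poly_Mapping.keys \<alpha>. Poly_Mapping.lookup \<alpha> j)"
  let ?F = "{f. \<forall>j. (j \<in> Poly_Mapping.keys \<alpha> \<longrightarrow> f j \<in> {..b})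
                 \<and> (j \<notin> Poly_Mapping.keys \<alpha> \<longrightarrow> f j = (0::nat))}"
  have "Poly_Mapping.lookup (fst p) \<in> ?F" if "p \<in> ?S" for p
  proof -
    have le: "Poly_Mapping.lookup (fst p) j \<le> Poly_Mapping.lookup \<alpha> j" for j
      using that lookup_add[of "fst p" "snd p" j] by (simp add: case_prod_beta)
    have "Poly_Mapping.lookup \<alpha> j \<le> b" if "j \<in> Poly_Mapping.keys \<alpha>" for j
      unfolding b_def using that by (intro member_le_sum) simp_all
    then have "Poly_Mapping.lookup (fst p) j \<le> b" if "j \<in> Poly_Mapping.keys \<alpha>" for j
      using that le[of j] order_trans by blast
    moreover have "Poly_Mapping.lookup (fst p) j = 0" if "j \<notin> Poly_Mapping.keys \<alpha>" for j
      using le[of j] that by (simp add: in_keys_iff)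
    ultimately show ?thesis by simp
  qed
  then have im: "(Poly_Mapping.lookup \<circ> fst) ` ?S \<subseteq> ?F"
    unfolding image_subset_iff comp_def by (rule ballI)
  have fin: "finite ?F" by (rule finite_set_of_finite_funs) simp_all
  have "inj_on (Poly_Mapping.lookup \<circ> fst) ?S"
  proof (rule inj_onI)
    fix p q assume pq: "p \<in> ?S" "q \<in> ?S"
      and eq: "(Poly_Mapping.lookup \<circ> fst) p = (Poly_Mapping.lookup \<circ> fst) q"
    from eq have fst: "fst p = fst q" by simp
    have "fst p + snd p = fst q + snd q" using pq by auto
    with fst have "snd p = snd q" by simp
    with fst show "p = q" by (rule prod_eqI)
  qed
  then show ?thesis using im fin by (rule inj_on_finite)
qed

lemma ps_mult_commute: "ps_mult f g = ps_mult g f"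
  unfolding ps_mult_def
  by (rule ext, rule sum.reindex_bij_witness[where i = prod.swap and j = prod.swap])
     (auto simp: add.commute mult.commute)

lemma ps_mult_assoc: "ps_mult (ps_mult f g) h = ps_mult f (ps_mult g h)"
proof
  fix \<alpha> :: "nat \<Rightarrow>\<^sub>0 nat"
  let ?S = "\<lambda>\<alpha> :: nat \<Rightarrow>\<^sub>0 nat. {(\<beta>, \<gamma>). \<beta> + \<gamma> = \<alpha>}"
  have "ps_mult (ps_mult f g) h \<alpha> =
      (\<Sum>p\<in>?S \<alpha>. \<Sum>q\<in>?S (fst p). f (fst q) * g (snd q) * h (snd p))"
    by (simp add: ps_mult_def sum_distrib_right case_prod_beta)
  also have "\<dots> = (\<Sum>(p, q)\<in>Sigma (?S \<alpha>) (\<lambda>p. ?S (fst p)). f (fst q) * g (snd q) * h (snd p))"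
    by (rule sum.Sigma) (use finite_splits in auto)
  \<comment> \<open>Both index sets parametrise the triples with sum \<open>\<alpha>\<close>; the
    two maps rebracket a triple.\<close>
  also have "\<dots> = (\<Sum>(p, q)\<in>Sigma (?S \<alpha>) (\<lambda>p. ?S (snd p)). f (fst p) * (g (fst q) * h (snd q)))"
    by (rule sum.reindex_bij_witness[where
          i = "\<lambda>((a, b), (c, d)). ((a + c, d), (a, c))" and
          j = "\<lambda>((a, b), (c, d)). ((c, d + b), (d, b))"])
       (auto simp: algebra_simps)
  also have "\<dots> = (\<Sum>p\<in>?S \<alpha>. \<Sum>q\<in>?S (snd p). f (fst p) * (g (fst q) * h (snd q)))"
    by (rule sum.Sigma[symmetric]) (use finite_splits in auto)
  also have "\<dots> = ps_mult f (ps_mult g h) \<alpha>"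
    by (simp add: ps_mult_def sum_distrib_left case_prod_beta)
  finally show "ps_mult (ps_mult f g) h \<alpha> = ps_mult f (ps_mult g h) \<alpha>" .
qed

lemma ps_mult_const: "ps_mult (ps_const c) f = ps_smult c f"
proof
  fix \<alpha> :: "nat \<Rightarrow>\<^sub>0 nat"
  have "ps_mult (ps_const c) f \<alpha> = (\<Sum>(\<beta>, \<gamma>)\<in>{(0, \<alpha>)}. ps_const c \<beta> * f \<gamma>)"
    unfolding ps_mult_def by (rule sum.mono_neutral_right) (auto simp: finite_splits ps_const_def split: if_splits)
  then show "ps_mult (ps_const c) f \<alpha> = ps_smult c f \<alpha>" by (simp add: ps_smult_def ps_const_def)
qed

lemma ps_mult_add: "ps_mult (ps_add f g) h = ps_add (ps_mult f h) (ps_mult g h)"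
  by (rule ext) (simp add: ps_mult_def ps_add_def distrib_right sum.distrib case_prod_beta)

instantiation mps :: comm_ring_1
begin
definition "0 = Mps (ps_const 0)"
definition "1 = Mps ps_one"
definition "f + g = Mps (ps_add (coeffs f) (coeffs g))"
definition "f - g = Mps (ps_diff (coeffs f) (coeffs g))"
definition "- f = Mps (\<lambda>\<alpha>. - coeffs f \<alpha>)"
definition "f * g = Mps (ps_mult (coeffs f) (coeffs g))"
instance
proof
  fix f g h :: mps
  show "f * g * h = f * (g * h)" by (simp add: times_mps_def ps_mult_assoc)
  show "f * g = g * f" by (simp add: times_mps_def ps_mult_commute)
  show "1 * f = f"
    by (rule mps_eqI) (simp add: times_mps_def one_mps_def ps_one_def ps_mult_const ps_smult_def)
  show "(f + g) * h = f * h + g * h" by (simp add: times_mps_def plus_mps_def ps_mult_add)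
  have "coeffs 0 0 \<noteq> coeffs 1 0" by (simp add: zero_mps_def one_mps_def ps_one_def ps_const_def)
  then show "(0::mps) \<noteq> 1" by metis
qed (auto intro!: mps_eqI simp: zero_mps_def plus_mps_def minus_mps_def uminus_mps_def
      ps_add_def ps_diff_def ps_const_def algebra_simps)
end

lemma Mps_mult: "Mps (ps_mult f g) = Mps f * Mps g"
  by (simp add: times_mps_def)

lemma Mps_add: "Mps (ps_add f g) = Mps f + Mps g"
  by (simp add: plus_mps_def)

lemma Mps_diff: "Mps (ps_diff f g) = Mps f - Mps g"
  by (simp add: minus_mps_def)

lemma Mps_one: "Mps ps_one = 1"
  by (simp add: one_mps_def)

lemma Mps_eq_iff: "Mps f = Mps g \<longleftrightarrow> f = g"
  by (simp add: Mps_inject)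

definition cst :: "K \<Rightarrow> mps" where
  "cst c = Mps (ps_const c)"

lemma Mps_smult: "Mps (ps_smult c f) = cst c * Mps f"
  by (simp add: cst_def ps_mult_const flip: Mps_mult)

lemma cst_simps [simp]: "cst 0 = 0" "cst 1 = 1"
  by (simp_all add: cst_def zero_mps_def one_mps_def ps_one_def)

lemma cst_add: "cst (a + b) = cst a + cst b"
  by (rule mps_eqI) (simp add: cst_def plus_mps_def ps_add_def ps_const_def)

lemma cst_diff: "cst (a - b) = cst a - cst b"
  by (rule mps_eqI) (simp add: cst_def minus_mps_def ps_diff_def ps_const_def)

lemma cst_mult: "cst (a * b) = cst a * cst b"
proof -
  have "cst a * cst b = Mps (ps_smult a (ps_const b))" by (simp add: Mps_smult cst_def)
  also have "ps_smult a (ps_const b) = ps_const (a * b)" by (auto simp: ps_smult_def ps_const_def)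
  finally show ?thesis by (simp add: cst_def)
qed

lemma cst_minus: "cst (- a) = - cst a"
  using cst_diff[of 0 a] by simp

lemma cst_mult_cancel: "c \<noteq> 0 \<Longrightarrow> cst c * f = cst c * g \<longleftrightarrow> f = g"
  by (metis cst_mult cst_simps(2) left_inverse mult.assoc mult_1)

lemma cst_cancel_inverse: "c \<noteq> 0 \<Longrightarrow> cst c * (cst (inverse c) * f) = f"
  by (simp flip: mult.assoc cst_mult)

lemma Mps_prodl: "Mps (ps_prodl fs) = prod_list (map Mps fs)"
  by (induction fs) (simp_all add: ps_prodl_def Mps_mult Mps_one)

lemma coeffs_sum: "coeffs (sum f A) \<alpha> = (\<Sum>x\<in>A. coeffs (f x) \<alpha>)"
  by (induction A rule: infinite_finite_induct)
     (simp_all add: zero_mps_def plus_mps_def ps_add_def ps_const_def)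

lemma coeffs_uminus: "coeffs (- f) \<alpha> = - coeffs f \<alpha>"
  by (simp add: uminus_mps_def)

text \<open>The Leibniz sums agree coefficient by coefficient; from here on row operations, column
  operations and Laplace expansion are available.\<close>

lemma Mps_det: "Mps (ps_det m M) = det (mat m m (\<lambda>(i, j). Mps (M i j)))"
proof (rule mps_eqI)
  fix \<alpha>
  let ?P = "{\<sigma>. \<sigma> permutes {0..<m}}"
  have sgn: "coeffs (signof \<sigma> * f) \<alpha> = of_int (sign \<sigma>) * coeffs f \<alpha>" for \<sigma> f
    by (cases "evenperm \<sigma>") (simp_all add: sign_def coeffs_uminus)
  have prd: "(\<Prod>i = 0..<m. Mps (M i (\<sigma> i))) = Mps (ps_prodl (map (\<lambda>i. M i (\<sigma> i)) [0..<m]))" for \<sigma>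
    by (simp add: Mps_prodl comp_def prod.list_conv_set_nth atLeast0LessThan)
  show "coeffs (Mps (ps_det m M)) \<alpha> = coeffs (det (mat m m (\<lambda>(i, j). Mps (M i j)))) \<alpha>"
    by (simp add: ps_det_def det_def coeffs_sum sgn prd cong: sum.cong_simp)
qed

section \<open>Invertibility of Omega in the ring of power series\<close>

definition Om :: "K \<Rightarrow> mps" where
  "Om b = Mps (Omega b)"

text \<open>The inverse is the product of all \<open>1 - b y_j\<close>: its coefficient at a
  squarefree monomial of degree d is \<open>(- b) ^ d\<close>, all others vanish. The convolution at
  \<open>\<alpha>\<close> becomes an alternating sum over the subsets of the support of
  \<open>\<alpha>\<close>, which is zero unless the support is empty.\<close>

lemma Omega_unit: "\<exists>g. g * Om b = 1"
proof
  define deg :: "(nat \<Rightarrow>\<^sub>0 nat) \<Rightarrow> nat" where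
    "deg \<alpha> = (\<Sum>j\<in>Poly_Mapping.keys \<alpha>. Poly_Mapping.lookup \<alpha> j)" for \<alpha>
  define sqfree :: "(nat \<Rightarrow>\<^sub>0 nat) \<Rightarrow> bool" where
    "sqfree \<alpha> \<longleftrightarrow> (\<forall>j. Poly_Mapping.lookup \<alpha> j \<le> 1)" for \<alpha>
  define g :: ps where "g \<alpha> = (if sqfree \<alpha> then (- b) ^ deg \<alpha> else 0)" for \<alpha>
  have deg_add: "deg (\<beta> + \<gamma>) = deg \<beta> + deg \<gamma>" for \<beta> \<gamma>
  proof -
    have *: "deg \<delta> = (\<Sum>j\<in>Poly_Mapping.keys \<beta> \<union> Poly_Mapping.keys \<gamma>. Poly_Mapping.lookup \<delta> j)"
      if "Poly_Mapping.keys \<delta> \<subseteq> Poly_Mapping.keys \<beta> \<union> Poly_Mapping.keys \<gamma>" for \<delta>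
      unfolding deg_def using that by (intro sum.mono_neutral_left) (auto simp: in_keys_iff)
    show ?thesis using keys_add[of \<beta> \<gamma>] by (simp add: * lookup_add sum.distrib)
  qed
  have "ps_mult g (Omega b) \<alpha> = ps_one \<alpha>" for \<alpha>
  proof -
    let ?A = "Poly_Mapping.keys \<alpha>"
    let ?S = "{(\<beta>, \<gamma>). \<beta> + \<gamma> = \<alpha> \<and> sqfree \<beta>}"
    \<comment> \<open>Squarefree exponent vectors are the indicator vectors of finite sets, so
      splittings with squarefree left part correspond to subsets of the support.\<close>
    define chi :: "nat set \<Rightarrow> (nat \<Rightarrow>\<^sub>0 nat)" where
      "chi X = Abs_poly_mapping (\<lambda>j. if j \<in> X then 1 else 0)" for X
    have chi: "Poly_Mapping.lookup (chi X) = (\<lambda>j. if j \<in> X then 1 else 0)" if "finite X" for X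
      unfolding chi_def by (subst Abs_poly_mapping_inverse) (use that in auto)
    have keys_chi: "Poly_Mapping.keys (chi X) = X" if "finite X" for X
      using chi[OF that] by (auto simp: in_keys_iff split: if_splits)
    have chi_keys: "chi (Poly_Mapping.keys \<beta>) = \<beta>" if "sqfree \<beta>" for \<beta>
    proof (rule poly_mapping_eqI)
      fix j
      have "Poly_Mapping.lookup \<beta> j \<le> 1" using that by (simp add: sqfree_def)
      then show "Poly_Mapping.lookup (chi (Poly_Mapping.keys \<beta>)) j = Poly_Mapping.lookup \<beta> j"
        by (simp add: chi in_keys_iff)
    qed
    have deg_chi: "deg (chi X) = card X" if "finite X" for X
      using that by (simp add: deg_def keys_chi chi)
    have "ps_mult g (Omega b) \<alpha> = (\<Sum>(\<beta>, \<gamma>)\<in>?S. g \<beta> * Omega b \<gamma>)"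
      unfolding ps_mult_def
      by (rule sum.mono_neutral_right) (auto simp: finite_splits g_def split: if_splits)
    also have "\<dots> = (\<Sum>(\<beta>, \<gamma>)\<in>?S. (- 1) ^ deg \<beta> * b ^ deg \<alpha>)"
    proof (rule sum.cong, safe)
      fix \<beta> \<gamma> assume "sqfree \<beta>"
      then have "g \<beta> * Omega b \<gamma> = (- b) ^ deg \<beta> * b ^ deg \<gamma>"
        by (simp add: g_def Omega_def deg_def)
      also have "\<dots> = (- 1) ^ deg \<beta> * b ^ deg (\<beta> + \<gamma>)"
        by (simp add: power_minus[of b] deg_add power_add)
      finally show "g \<beta> * Omega b \<gamma> = (- 1) ^ deg \<beta> * b ^ deg (\<beta> + \<gamma>)" .
    qed
    also have "\<dots> = (\<Sum>X\<in>Pow ?A. (- 1) ^ card X * b ^ deg \<alpha>)"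
    proof (rule sum.reindex_bij_witness[where i = "\<lambda>X. (chi X, \<alpha> - chi X)" and
            j = "\<lambda>(\<beta>, \<gamma>). Poly_Mapping.keys \<beta>"])
      fix X assume X: "X \<in> Pow ?A"
      then have fin: "finite X" by (auto intro: finite_subset)
      have "chi X + (\<alpha> - chi X) = \<alpha>"
        by (rule poly_mapping_eqI) (use X in \<open>auto simp: lookup_add lookup_minus chi[OF fin] in_keys_iff\<close>)
      moreover have "sqfree (chi X)" by (simp add: sqfree_def chi[OF fin])
      ultimately show "(chi X, \<alpha> - chi X) \<in> ?S" by simp
      show "(case (chi X, \<alpha> - chi X) of (\<beta>, \<gamma>) \<Rightarrow> Poly_Mapping.keys \<beta>) = X" by (simp add: keys_chi fin)
    next
      fix p assume "p \<in> ?S"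
      then obtain \<beta> \<gamma> where p: "p = (\<beta>, \<gamma>)" "\<beta> + \<gamma> = \<alpha>" "sqfree \<beta>" by auto
      show "(chi (case p of (\<beta>, \<gamma>) \<Rightarrow> Poly_Mapping.keys \<beta>), \<alpha> - chi (case p of (\<beta>, \<gamma>) \<Rightarrow> Poly_Mapping.keys \<beta>)) = p"
        using p by (auto simp: chi_keys)
      show "(case p of (\<beta>, \<gamma>) \<Rightarrow> Poly_Mapping.keys \<beta>) \<in> Pow ?A"
        using p by (auto simp: in_keys_iff lookup_add)
      show "(- 1) ^ card (case p of (\<beta>, \<gamma>) \<Rightarrow> Poly_Mapping.keys \<beta>) * b ^ deg \<alpha> = (case p of (\<beta>, \<gamma>) \<Rightarrow> (- 1) ^ deg \<beta> * b ^ deg \<alpha>)"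
        using p chi_keys[of \<beta>] deg_chi[of "Poly_Mapping.keys \<beta>"] by simp
    qed
    also have "\<dots> = (\<Sum>X\<in>Pow ?A. (\<Prod>x\<in>X. - 1) * (\<Prod>x\<in>?A - X. 1)) * b ^ deg \<alpha>"
      by (simp add: sum_distrib_right)
    also have "\<dots> = (\<Prod>x\<in>?A. - 1 + 1) * b ^ deg \<alpha>"
      by (subst prod_add) auto
    also have "\<dots> = ps_one \<alpha>"
      by (cases "\<alpha> = 0") (auto simp: ps_one_def ps_const_def deg_def)
    finally show ?thesis .
  qed
  then show "Mps g * Om b = 1" by (auto intro!: mps_eqI simp: Om_def times_mps_def one_mps_def)
qed

text \<open>\<open>ps_inv\<close> is a definite description; its uniqueness part is the uniqueness
  of inverses in a commutative ring.\<close>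

lemma Mps_inv: "g * Mps f = 1 \<Longrightarrow> Mps (ps_inv f) = g"
proof -
  assume g: "g * Mps f = 1"
  have "ps_inv f = coeffs g"
    unfolding ps_inv_def
  proof (rule the_equality)
    show "ps_mult (coeffs g) f = ps_one" using g by (simp flip: Mps_eq_iff add: Mps_mult Mps_one)
    fix h assume "ps_mult h f = ps_one"
    then have "Mps h * Mps f = 1" by (simp flip: Mps_mult Mps_one)
    then have "Mps h = g" using g by (metis mult.assoc mult.commute mult_1)
    then show "h = coeffs g" by auto
  qed
  then show ?thesis by simp
qed

section \<open>The action on coefficients\<close>

definition frac1 :: "lpoly \<Rightarrow> K" where
  "frac1 p = Fraction_Field.Fract p 1"

lemma frac1_add: "frac1 (p + q) = frac1 p + frac1 q"
  by (simp add: frac1_def)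

lemma frac1_mult: "frac1 (p * q) = frac1 p * frac1 q"
  by (simp add: frac1_def)

lemma frac1_0 [simp]: "frac1 0 = 0" and frac1_1 [simp]: "frac1 1 = 1"
  by (simp_all add: frac1_def Zero_fract_def One_fract_def)

lemma frac1_diff: "frac1 (p - q) = frac1 p - frac1 q"
  by (simp add: frac1_def)

lemma frac1_eq_iff: "frac1 p = frac1 q \<longleftrightarrow> p = q"
  by (simp add: frac1_def eq_fract)

lemma frac1_sum: "frac1 (sum f A) = (\<Sum>x\<in>A. frac1 (f x))"
  by (induction A rule: infinite_finite_induct) (simp_all add: frac1_add)

lemma frac1_cmul: "frac1 (frag_cmul k p) = of_int k * frac1 p"
proof (induction k rule: int_induct[of _ 0])
  case (step1 i)
  then show ?case by (simp add: frag_cmul_distrib frac1_add distrib_right)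
next
  case (step2 i)
  then show ?case by (simp add: frag_cmul_diff_distrib frac1_diff left_diff_distrib)
qed simp

text \<open>Exponent vectors and Laurent polynomials are both finitely supported integer functions,
  that is, elements of free abelian groups. Hence \<open>frag_of\<close>, \<open>frag_cmul\<close>
  and \<open>frag_extend\<close> serve on both levels.\<close>

definition xmon :: "lexp \<Rightarrow> K" where
  "xmon \<mu> = frac1 (frag_of \<mu>)"

lemma xmon_add: "xmon (\<mu> + \<nu>) = xmon \<mu> * xmon \<nu>"
  by (simp add: xmon_def mult_single flip: frac1_mult)

lemma xmon_0 [simp]: "xmon 0 = 1"
  by (simp add: xmon_def)

lemma xmon_nonzero [simp]: "xmon \<mu> \<noteq> 0"
  using frac1_eq_iff[of "frag_of \<mu>" 0] by (simp add: xmon_def)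

lemma xmon_uminus: "xmon (- \<mu>) = inverse (xmon \<mu>)"
  by (metis xmon_0 xmon_add add.left_inverse inverse_unique mult.commute)

lemma xmon_sum: "xmon (sum f A) = (\<Prod>x\<in>A. xmon (f x))"
  by (induction A rule: infinite_finite_induct) (simp_all add: xmon_add)

lemma xmon_cmul: "xmon (frag_cmul k \<mu>) = power_int (xmon \<mu>) k"
proof (induction k rule: int_induct[of _ 0])
  case (step1 i)
  then show ?case by (simp add: frag_cmul_distrib xmon_add power_int_add)
next
  case (step2 i)
  have "frag_cmul (i - 1) \<mu> = frag_cmul i \<mu> + - \<mu>"
    by (simp add: frag_cmul_diff_distrib)
  then show ?case
    using step2 by (simp only: xmon_add xmon_uminus) (simp add: power_int_diff divide_inverse)
qed simp

lemma xmon_eq_iff: "xmon \<mu> = xmon \<nu> \<longleftrightarrow> \<mu> = \<nu>"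
  by (simp add: xmon_def frac1_eq_iff frag_of_eq)

text \<open>The exponent vector of the exponential of a_j; the relation a_1 + ... + a_n = 0
  eliminates a_n.\<close>

definition eps :: "nat \<Rightarrow> nat \<Rightarrow> lexp" where
  "eps n j = (if j < n then frag_of j else - (\<Sum>t\<in>{1..<n}. frag_of t))"

lemma ea_eq_xmon: "ea n i = xmon (eps n (idx n i))"
proof -
  have "Xv j = xmon (frag_of j)" for j by (simp add: Xv_def xmon_def frac1_def)
  then show ?thesis by (simp add: ea_def eps_def Let_def xmon_uminus xmon_sum)
qed

lemma idx_bounds: "0 < n \<Longrightarrow> 1 \<le> idx n i \<and> idx n i \<le> n"
proof -
  assume "0 < n"
  then have "0 \<le> (i - 1) mod int n" "(i - 1) mod int n < int n" by simp_all
  then show ?thesis unfolding idx_def by linarith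
qed

lemma idx_nat: "1 \<le> j \<Longrightarrow> j \<le> n \<Longrightarrow> idx n (int j) = j"
  unfolding idx_def by (subst mod_pos_pos_trivial) auto

lemma eps_sum: "0 < n \<Longrightarrow> (\<Sum>j\<in>{1..n}. eps n j) = 0"
proof -
  assume n: "0 < n"
  then have "{1..n} = insert n {1..<n}" by auto
  then have "(\<Sum>j\<in>{1..n}. eps n j) = eps n n + (\<Sum>j\<in>{1..<n}. eps n j)" by simp
  also have "(\<Sum>j\<in>{1..<n}. eps n j) = (\<Sum>j\<in>{1..<n}. frag_of j)" by (simp add: eps_def)
  finally show ?thesis by (simp add: eps_def)
qed

text \<open>For n at least 2, coordinate 1 of \<open>eps n n\<close> is -1, whereas the other
  vectors are unit vectors and have no negative coordinate.\<close>

lemma eps_inj: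
  assumes "2 \<le> n" "1 \<le> i" "i \<le> n" "1 \<le> j" "j \<le> n" "eps n i = eps n j"
  shows "i = j"
proof -
  have lt: "Poly_Mapping.lookup (eps n i) t = (if t = i then 1 else 0)" if "i < n" for i t
    using that by (simp add: eps_def)
  have eq: "Poly_Mapping.lookup (eps n n) t = (if t \<in> {1..<n} then - 1 else 0)" for t
    by (simp add: eps_def lookup_sum)
  consider "i < n" "j < n" | "i = n" "j < n" | "i < n" "j = n" | "i = n" "j = n"
    using assms by linarith
  then show ?thesis
  proof cases
    case 1
    then show ?thesis using lt[of i i] lt[of j i] assms by (simp split: if_splits)
  next
    case 2
    then show ?thesis using lt[of j 1] eq[of 1] assms by (simp split: if_splits)
  next
    case 3
    then show ?thesis using lt[of i 1] eq[of 1] assms by (simp split: if_splits)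
  qed simp
qed

lemma ea_nonzero [simp]: "ea n i \<noteq> 0"
  by (simp add: ea_eq_xmon)

lemma ea_eq_iff:
  assumes "2 \<le> n"
  shows "ea n i = ea n j \<longleftrightarrow> i mod int n = j mod int n"
proof -
  have "ea n i = ea n j \<longleftrightarrow> idx n i = idx n j"
    using eps_inj[OF assms] idx_bounds[of n] assms by (auto simp: ea_eq_xmon xmon_eq_iff)
  also have "\<dots> \<longleftrightarrow> (i - 1) mod int n = (j - 1) mod int n"
    using assms by (simp add: idx_def eq_nat_nat_iff)
  also have "\<dots> \<longleftrightarrow> i mod int n = j mod int n"
    by (metis diff_add_cancel mod_add_left_eq mod_diff_left_eq)
  finally show ?thesis .
qed

text \<open>A permutation of the \<open>a_i\<close> acts on exponent vectors by an additive involution,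
  hence on Laurent polynomials injectively, which is what makes \<open>kmap\<close> a field homomorphism.\<close>

lemma kperm_field_hom:
  assumes n: "0 < n" and \<pi>: "\<pi> permutes {1..n}" and inv: "\<And>i. \<pi> (\<pi> i) = i"
  shows "field_hom (kperm n \<pi>)" and "kperm n \<pi> (ea n i) = ea n (int (\<pi> (idx n i)))"
proof -
  define v where "v j = (if 1 \<le> j \<and> j < n then ea n (int (\<pi> j)) else Xv j)" for j
  define \<nu> where "\<nu> j = (if 1 \<le> j \<and> j < n then eps n (\<pi> j) else frag_of j)" for j
  \<comment> \<open>\<open>A\<close> is the action on exponent vectors and \<open>B\<close> the
    induced action on Laurent polynomials, each obtained by linear extension.\<close>
  define A where "A = frag_extend \<nu>"
  define B where "B = frag_extend (frag_of \<circ> A)"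
  have range: "1 \<le> \<pi> j" "\<pi> j \<le> n" if "1 \<le> j" "j \<le> n" for j
    using permutes_in_image[OF \<pi>, of j] that by auto
  have v: "v j = xmon (\<nu> j)" for j
    using range[of j] by (simp add: v_def \<nu>_def ea_eq_xmon idx_nat) (simp add: Xv_def xmon_def frac1_def)
  have A_add: "A (\<mu> + \<mu>') = A \<mu> + A \<mu>'" and A_uminus: "A (- \<mu>) = - A \<mu>" and A_0: "A 0 = 0"
    and A_of: "A (frag_of j) = \<nu> j" for \<mu> \<mu>' j
    by (simp_all add: A_def frag_extend_add frag_extend_minus)
  have A_eps: "A (eps n j) = eps n (\<pi> j)" if "1 \<le> j" "j \<le> n" for j
  proof (cases "j < n")
    case True
    then show ?thesis using that by (simp add: eps_def[of n j] A_of \<nu>_def)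
  next
    case False
    \<comment> \<open>The last vector is minus the sum of the others. Its image is
      \<open>eps n (\<pi> n)\<close> minus the sum over all of \<open>{1..n}\<close>, and that sum
      vanishes because \<open>\<pi>\<close> only reorders it.\<close>
    have "A (eps n n) = - (\<Sum>t\<in>{1..<n}. eps n (\<pi> t))"
      by (simp add: eps_def[of n n] A_uminus) (simp add: A_def frag_extend_sum \<nu>_def)
    also have "\<dots> = eps n (\<pi> n) - (\<Sum>t\<in>insert n {1..<n}. eps n (\<pi> t))" by simp
    also have "insert n {1..<n} = {1..n}" using n by auto
    also have "(\<Sum>t\<in>{1..n}. eps n (\<pi> t)) = (\<Sum>t\<in>{1..n}. eps n t)"
      by (rule sum.permute[OF \<pi>, symmetric, unfolded comp_def])
    finally show ?thesis using False that eps_sum[OF n] by simp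
  qed
  have A_\<nu>: "A (\<nu> j) = frag_of j" for j
  proof (cases "1 \<le> j \<and> j < n")
    case True
    then have "A (\<nu> j) = eps n (\<pi> (\<pi> j))" using A_eps[of "\<pi> j"] range[of j] by (simp add: \<nu>_def)
    then show ?thesis using True by (simp add: inv eps_def)
  qed (auto simp: \<nu>_def A_of)
  have AA: "A (A \<mu>) = \<mu>" for \<mu>
    using subset_UNIV
    by (induction \<mu> rule: frag_induction)
       (simp_all add: A_0 A_of A_\<nu>, simp add: A_def frag_extend_diff)
  have B_0: "B 0 = 0" and B_diff: "B (p - q) = B p - B q" and B_add: "B (p + q) = B p + B q"
    and B_of: "B (frag_of \<mu>) = frag_of (A \<mu>)" for p q \<mu>
    by (simp_all add: B_def frag_extend_diff frag_extend_add)
  have BB: "B (B p) = p" for p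
  proof -
    have "B (B p) = frag_extend (frag_of \<circ> (A \<circ> A)) p"
      by (simp add: B_def frag_extend_compose comp_assoc)
    also have "\<dots> = p" by (simp add: AA comp_def flip: frag_expansion)
    finally show ?thesis .
  qed
  have B_mult_of: "B (frag_of \<mu> * q) = B (frag_of \<mu>) * B q" for \<mu> q
    using subset_UNIV
    by (induction q rule: frag_induction)
       (simp_all add: B_0 B_of mult_single A_add right_diff_distrib B_diff)
  have B_mult: "B (p * q) = B p * B q" for p q
    using subset_UNIV
    by (induction p rule: frag_induction)
       (simp_all add: B_0 B_mult_of left_diff_distrib B_diff)
  have eval: "lpoly_eval v p = frac1 (B p)" for p
  proof -
    have "(\<Prod>j\<in>Poly_Mapping.keys \<mu>. power_int (v j) (Poly_Mapping.lookup \<mu> j)) = xmon (A \<mu>)" for \<mu>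
      by (simp add: A_def frag_extend_def xmon_sum xmon_cmul v)
    then show ?thesis
      by (simp add: lpoly_eval_def B_def frag_extend_def frac1_sum frac1_cmul xmon_def)
  qed
  have B_nz: "B q \<noteq> 0" if "q \<noteq> 0" for q using BB[of q] B_0 that by auto
  have kmap: "kperm n \<pi> (Fraction_Field.Fract p q) = frac1 (B p) / frac1 (B q)" if q: "q \<noteq> 0" for p q
  proof -
    \<comment> \<open>\<open>kmap\<close> evaluates at a fraction chosen by \<open>SOME\<close>.
      Cross-multiplying under the multiplicative map \<open>B\<close> shows that the value does not
      depend on the choice; injectivity of \<open>B\<close> keeps denominators nonzero.\<close>
    define pq where "pq = (SOME pq. snd pq \<noteq> 0 \<and> Fraction_Field.Fract p q = Fraction_Field.Fract (fst pq) (snd pq))"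
    have pq: "snd pq \<noteq> 0" "Fraction_Field.Fract p q = Fraction_Field.Fract (fst pq) (snd pq)"
      using someI[of "\<lambda>pq. snd pq \<noteq> 0 \<and> Fraction_Field.Fract p q = Fraction_Field.Fract (fst pq) (snd pq)" "(p, q)"] q
      by (simp_all add: pq_def)
    then have "B (p * snd pq) = B (fst pq * q)" using q by (simp add: eq_fract)
    then have "frac1 (B p) * frac1 (B (snd pq)) = frac1 (B (fst pq)) * frac1 (B q)"
      by (simp add: B_mult flip: frac1_mult)
    moreover have "frac1 (B (snd pq)) \<noteq> 0" "frac1 (B q) \<noteq> 0"
      using pq(1) q B_nz frac1_eq_iff[of _ 0] by simp_all
    moreover have "kperm n \<pi> (Fraction_Field.Fract p q) = frac1 (B (fst pq)) / frac1 (B (snd pq))"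
      unfolding kperm_def kmap_def v_def[symmetric] pq_def[symmetric]
      by (simp add: eval case_prod_beta)
    ultimately show ?thesis by (simp add: frac_eq_eq)
  qed
  have B_1: "B 1 = 1" using B_of[of 0] by (simp add: A_0)
  have nz: "frac1 (B q) \<noteq> 0" if "q \<noteq> 0" for q
    using B_nz[OF that] frac1_eq_iff[of _ 0] by simp
  show "field_hom (kperm n \<pi>)"
  proof
    show "kperm n \<pi> 0 = 0" using kmap[of 1 0] by (simp add: Zero_fract_def[symmetric] B_0)
    show "kperm n \<pi> 1 = 1" using kmap[of 1 1] by (simp add: One_fract_def[symmetric] B_1)
    fix x y :: K
    obtain a b c d where x: "x = Fraction_Field.Fract a b" "b \<noteq> 0" and y: "y = Fraction_Field.Fract c d" "d \<noteq> 0"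
      by (metis Fraction_Field.Fract_cases)
    show "kperm n \<pi> (x + y) = kperm n \<pi> x + kperm n \<pi> y"
      using x y nz[of b] nz[of d]
      by (simp add: kmap B_add B_mult frac1_add frac1_mult add_frac_eq)
    show "kperm n \<pi> (x * y) = kperm n \<pi> x * kperm n \<pi> y"
      using x y by (simp add: kmap B_mult frac1_mult)
  qed
  have ix: "1 \<le> idx n i" "idx n i \<le> n" using idx_bounds[OF n] by simp_all
  have "kperm n \<pi> (ea n i) = frac1 (B (frag_of (eps n (idx n i))))"
    by (simp add: ea_eq_xmon xmon_def frac1_def kmap B_1)
  also have "\<dots> = xmon (eps n (\<pi> (idx n i)))" using A_eps[OF ix] by (simp add: B_of xmon_def)
  also have "\<dots> = ea n (int (\<pi> (idx n i)))" using idx_nat[OF range[OF ix]] by (simp add: ea_eq_xmon)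
  finally show "kperm n \<pi> (ea n i) = ea n (int (\<pi> (idx n i)))" .
qed

lemma swapf_eq: "swapf a b = transpose a b"
  by (simp add: swapf_def transpose_def fun_eq_iff)

lemma idx_eq_iff:
  assumes "1 \<le> t" "t \<le> n"
  shows "idx n p = t \<longleftrightarrow> p mod int n = int t mod int n"
proof -
  have n: "0 < n" using assms by simp
  have "idx n p = t \<longleftrightarrow> (p - 1) mod int n = int t - 1"
    using n assms by (auto simp: idx_def)
  also have "int t - 1 = (int t - 1) mod int n" using assms by simp
  also have "(p - 1) mod int n = (int t - 1) mod int n \<longleftrightarrow> p mod int n = int t mod int n"
    by (metis diff_add_cancel mod_add_left_eq mod_diff_left_eq)
  finally show ?thesis .
qed

definition mps_map :: "(K \<Rightarrow> K) \<Rightarrow> mps \<Rightarrow> mps" where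
  "mps_map \<kappa> f = Mps (\<lambda>\<alpha>. \<kappa> (coeffs f \<alpha>))"

lemma Mps_perm: "Mps (ps_perm n \<pi> f) = mps_map (kperm n \<pi>) (Mps f)"
  by (simp add: mps_map_def ps_perm_def)

lemma mps_map_hom:
  assumes "field_hom \<kappa>"
  shows "comm_ring_hom (mps_map \<kappa>)"
proof -
  interpret field_hom \<kappa> by fact
  show ?thesis
    by unfold_locales
       (auto intro!: mps_eqI simp: mps_map_def zero_mps_def one_mps_def plus_mps_def times_mps_def
          ps_const_def ps_one_def ps_add_def ps_mult_def case_prod_beta hom_distribs)
qed

lemma mps_map_cst:
  assumes "field_hom \<kappa>"
  shows "mps_map \<kappa> (cst c) = cst (\<kappa> c)"
proof -
  interpret field_hom \<kappa> by fact
  show ?thesis by (auto intro!: mps_eqI simp: mps_map_def cst_def ps_const_def)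
qed

lemma mps_map_Om:
  assumes "field_hom \<kappa>"
  shows "mps_map \<kappa> (Om b) = Om (\<kappa> b)"
proof -
  interpret field_hom \<kappa> by fact
  show ?thesis by (auto intro!: mps_eqI simp: mps_map_def Om_def Omega_def hom_distribs)
qed

section \<open>Complete homogeneous polynomials and divided differences\<close>

text \<open>The bound \<open>m\<close> on each exponent follows from the sum being \<open>m\<close>.
  Without it the index sets are easy to relate when a single exponent is changed.\<close>

lemma hset_alt:
  assumes "finite S"
  shows "hset m S = (\<Sum>\<alpha>\<in>{\<alpha> \<in> extensional S. sum \<alpha> S = m}. \<Prod>x\<in>S. x ^ \<alpha> x)"
proof -
  have "\<alpha> x \<le> sum \<alpha> S" if "x \<in> S" for x and \<alpha> :: "K \<Rightarrow> nat"
    using that assms by (intro member_le_sum) simp_all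
  then have "{\<alpha>. \<alpha> \<in> S \<rightarrow>\<^sub>E {0..m} \<and> sum \<alpha> S = m} = {\<alpha> \<in> extensional S. sum \<alpha> S = m}"
    by (auto simp: PiE_def Pi_def)
  then show ?thesis by (simp add: hset_def)
qed

lemma finite_hset_index:
  assumes "finite S"
  shows "finite {\<alpha> \<in> extensional S. sum \<alpha> S = (m :: nat)}"
proof (rule finite_subset)
  have "\<alpha> x \<le> sum \<alpha> S" if "x \<in> S" for x and \<alpha> :: "'a \<Rightarrow> nat"
    using that assms by (intro member_le_sum) simp_all
  then show "{\<alpha> \<in> extensional S. sum \<alpha> S = m} \<subseteq> S \<rightarrow>\<^sub>E {0..m}"
    by (auto simp: PiE_def Pi_def)
qed (use assms in \<open>simp add: finite_PiE\<close>)

lemma hset_0: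
  assumes "finite S"
  shows "hset 0 S = 1"
proof -
  have "{\<alpha> \<in> extensional S. sum \<alpha> S = (0 :: nat)} = {\<lambda>x\<in>S. 0}"
    using assms by (auto simp: extensional_def fun_eq_iff)
  then show ?thesis by (simp add: hset_alt assms)
qed

lemma hset_empty: "hset (Suc m) {} = 0"
  by (simp add: hset_alt)

text \<open>Split the monomials by whether \<open>x\<close> occurs in them, and take out one factor
  \<open>x\<close> if it does.\<close>

lemma hset_insert:
  assumes S: "finite S" "x \<notin> S"
  shows "hset (Suc m) (insert x S) = hset (Suc m) S + x * hset m (insert x S)"
proof -
  let ?I = "\<lambda>m S. {\<alpha> \<in> extensional S. sum \<alpha> S = (m :: nat)}"
  let ?p = "\<lambda>\<alpha>. \<Prod>y\<in>insert x S. y ^ \<alpha> y"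
  have upd: "sum (\<alpha>(x := k)) S = sum \<alpha> S" "(\<Prod>y\<in>S. y ^ (\<alpha>(x := k)) y) = (\<Prod>y\<in>S. y ^ \<alpha> y)"
    for \<alpha> :: "K \<Rightarrow> nat" and k
    using S by (auto intro!: sum.cong prod.cong)
  have fin: "finite (?I (Suc m) (insert x S))" using S by (intro finite_hset_index) simp
  have "hset (Suc m) (insert x S) = sum ?p (?I (Suc m) (insert x S))"
    using S by (intro hset_alt) simp
  also have "?I (Suc m) (insert x S) =
      {\<alpha> \<in> ?I (Suc m) (insert x S). \<alpha> x = 0} \<union> {\<alpha> \<in> ?I (Suc m) (insert x S). \<alpha> x \<noteq> 0}"
    by blast
  also have "sum ?p \<dots> =
      sum ?p {\<alpha> \<in> ?I (Suc m) (insert x S). \<alpha> x = 0} + sum ?p {\<alpha> \<in> ?I (Suc m) (insert x S). \<alpha> x \<noteq> 0}"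
    by (rule sum.union_disjoint) (auto intro: finite_subset[OF _ fin])
  also have "sum ?p {\<alpha> \<in> ?I (Suc m) (insert x S). \<alpha> x = 0} = hset (Suc m) S"
    unfolding hset_alt[OF S(1)]
    by (rule sum.reindex_bij_witness[where i = "\<lambda>\<alpha>. \<alpha>(x := 0)" and j = "\<lambda>\<alpha>. \<alpha>(x := undefined)"])
       (use S upd in \<open>auto simp: extensional_def fun_eq_iff\<close>)
  also have "sum ?p {\<alpha> \<in> ?I (Suc m) (insert x S). \<alpha> x \<noteq> 0} =
      (\<Sum>\<alpha>\<in>?I m (insert x S). x * ?p \<alpha>)"
    by (rule sum.reindex_bij_witness[where i = "\<lambda>\<alpha>. \<alpha>(x := Suc (\<alpha> x))" and
          j = "\<lambda>\<alpha>. \<alpha>(x := \<alpha> x - 1)"])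
       (use S upd in \<open>auto simp: extensional_def fun_eq_iff gr0_conv_Suc\<close>)
  finally show ?thesis using S by (simp add: hset_alt sum_distrib_left)
qed

text \<open>Expand the polynomial in all variables once by \<open>x\<close> and once by
  \<open>y\<close>, and subtract.\<close>

lemma hset_exchange:
  assumes "finite S" "x \<notin> S" "y \<notin> S" "x \<noteq> y"
  shows "hset (Suc m) (insert x S) - hset (Suc m) (insert y S) = (x - y) * hset m (insert x (insert y S))"
proof -
  have "hset (Suc m) (insert x (insert y S)) = hset (Suc m) (insert y S) + x * hset m (insert x (insert y S))"
    using assms by (simp add: hset_insert)
  moreover have "hset (Suc m) (insert y (insert x S)) = hset (Suc m) (insert x S) + y * hset m (insert y (insert x S))"
    using assms by (simp add: hset_insert)
  ultimately show ?thesis by (simp add: insert_commute[of y x] algebra_simps)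
qed

text \<open>Again expand by \<open>x\<close> and by \<open>y\<close>, but weight the two expansions
  with \<open>x\<close> and \<open>y\<close> so that the terms of lower degree cancel. This
  weighting is the one occurring in the operators \<open>D_i\<close>.\<close>

lemma hset_isobaric:
  assumes "finite S" "x \<notin> S" "y \<notin> S" "x \<noteq> y"
  shows "(x - y) * hset m (insert x (insert y S)) = x * hset m (insert x S) - y * hset m (insert y S)"
proof (cases m)
  case (Suc k)
  have "hset (Suc k) (insert x (insert y S)) = hset (Suc k) (insert y S) + x * hset k (insert x (insert y S))"
    using assms by (simp add: hset_insert)
  moreover have "hset (Suc k) (insert y (insert x S)) = hset (Suc k) (insert x S) + y * hset k (insert y (insert x S))"
    using assms by (simp add: hset_insert)
  ultimately have "x * hset (Suc k) (insert x (insert y S)) - y * hset (Suc k) (insert x (insert y S)) =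
      x * (hset (Suc k) (insert x S) + y * hset k (insert x (insert y S))) -
      y * (hset (Suc k) (insert y S) + x * hset k (insert x (insert y S)))"
    by (simp add: insert_commute[of y x])
  then show ?thesis unfolding Suc by (simp add: algebra_simps)
qed (use assms in \<open>simp add: hset_0\<close>)

text \<open>Since \<open>hset\<close> depends on a set, \<open>\<kappa>\<close> must not merge
  elements; as a field homomorphism it is injective, and the recursion for \<open>hset\<close>
  carries over.\<close>

lemma hset_image:
  assumes \<kappa>: "field_hom \<kappa>" and "finite S"
  shows "hset m (\<kappa> ` S) = \<kappa> (hset m S)"
proof -
  interpret field_hom \<kappa> by fact
  have inj: "\<kappa> x = \<kappa> y \<Longrightarrow> x = y" for x y
  proof (rule ccontr)
    assume eq: "\<kappa> x = \<kappa> y" and ne: "x \<noteq> y"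
    then have "\<kappa> ((x - y) * inverse (x - y)) = 0" by (simp add: hom_mult hom_minus)
    with ne show False by simp
  qed
  show ?thesis using \<open>finite S\<close>
  proof (induction S arbitrary: m rule: finite_induct)
    case empty
    show ?case by (cases m) (simp_all add: hset_0 hset_empty)
  next
    case (insert x S)
    then have notin: "\<kappa> x \<notin> \<kappa> ` S" using inj by blast
    show ?case
    proof (induction m)
      case 0
      show ?case using insert.hyps by (simp add: hset_0)
    next
      case (Suc m)
      then show ?case using insert notin by (simp add: hset_insert hom_add hom_mult)
    qed
  qed
qed

text \<open>Up to the sign \<open>(-1)^(|A|-1)\<close> this is the divided difference of \<open>x \<mapsto> Om (1 - x)\<close> at the
  nodes \<open>u t\<close>, in Lagrange form; it makes the symmetry of the \<open>z\<close> entries visible.\<close>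

definition divdiff :: "(nat \<Rightarrow> K) \<Rightarrow> nat set \<Rightarrow> mps" where
  "divdiff u A = (\<Sum>t\<in>A. cst (\<Prod>s\<in>A - {t}. inverse (u s - u t)) * Om (1 - u t))"

lemma divdiff_single [simp]: "divdiff u {p} = Om (1 - u p)"
  by (simp add: divdiff_def)

text \<open>Compare the coefficients of each \<open>Om (1 - u t)\<close>. At \<open>a\<close> and
  \<open>b\<close> one factor cancels; for \<open>t\<close> in \<open>A\<close> it is the partial
  fraction identity (Y - X)/(XY) = 1/X - 1/Y with X = \<open>u a - u t\<close> and Y =
  \<open>u b - u t\<close>.\<close>

lemma divdiff_rec:
  assumes A: "finite A" "a \<notin> A" "b \<notin> A" "a \<noteq> b" and inj: "inj_on u (insert a (insert b A))"
  shows "cst (u b - u a) * divdiff u (insert a (insert b A)) = divdiff u (insert a A) - divdiff u (insert b A)"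
proof -
  let ?c = "\<lambda>A t. \<Prod>s\<in>A - {t}. inverse (u s - u t)"
  let ?w = "\<lambda>t. Om (1 - u t)"
  have ne: "u x \<noteq> u y" if "x \<in> insert a (insert b A)" "y \<in> insert a (insert b A)" "x \<noteq> y" for x y
    using inj_onD[OF inj, of x y] that by blast
  have ins: "divdiff u (insert x B) = cst (?c (insert x B) x) * ?w x + (\<Sum>t\<in>B. cst (?c (insert x B) t) * ?w t)"
    if "finite B" "x \<notin> B" for x B
    using that by (simp add: divdiff_def)
  have c_a: "(u b - u a) * ?c (insert a (insert b A)) a = ?c (insert a A) a"
  proof -
    have "insert a (insert b A) - {a} = insert b A" "insert a A - {a} = A" using A by auto
    then show ?thesis using A ne[of a b] by simp
  qed
  have c_b: "(u b - u a) * ?c (insert a (insert b A)) b = - ?c (insert b A) b"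
  proof -
    have "insert a (insert b A) - {b} = insert a A" "insert b A - {b} = A" using A by auto
    then show ?thesis using A ne[of a b] by (simp add: field_simps)
  qed
  have c_t: "(u b - u a) * ?c (insert a (insert b A)) t = ?c (insert a A) t - ?c (insert b A) t"
    if t: "t \<in> A" for t
  proof -
    have sets: "insert a (insert b A) - {t} = insert a (insert b (A - {t}))"
      "insert a A - {t} = insert a (A - {t})" "insert b A - {t} = insert b (A - {t})"
      using A t by auto
    have "(Y - X) * (inverse X * (inverse Y * P)) = inverse X * P - inverse Y * P"
      if "X \<noteq> 0" "Y \<noteq> 0" for X Y P :: K
      using that by (simp add: field_simps)
    from this[of "u a - u t" "u b - u t" "\<Prod>s\<in>A - {t}. inverse (u s - u t)"] show ?thesis
      unfolding sets using A ne[of a t] ne[of b t] t by fastforce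
  qed
  have "cst (u b - u a) * divdiff u (insert a (insert b A)) =
      cst ((u b - u a) * ?c (insert a (insert b A)) a) * ?w a +
      cst ((u b - u a) * ?c (insert a (insert b A)) b) * ?w b +
      (\<Sum>t\<in>A. cst ((u b - u a) * ?c (insert a (insert b A)) t) * ?w t)"
    using A by (simp only: divdiff_def sum.insert finite_insert insert_iff simp_thms
        cst_mult distrib_left sum_distrib_left mult.assoc add.assoc)
  also have "\<dots> = divdiff u (insert a A) - divdiff u (insert b A)"
    unfolding c_a c_b using A c_t
    by (simp add: ins cst_minus cst_diff left_diff_distrib sum_subtractf)
  finally show ?thesis .
qed

section \<open>The exchange of two adjacent variables\<close>

locale adj_swap =
  fixes \<kappa> :: "K \<Rightarrow> K" and u :: "nat \<Rightarrow> K" and N j :: nat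
  assumes \<kappa>: "field_hom \<kappa>"
    and inj_u: "inj_on u {..<N}"
    and j: "Suc j < N"
    and \<kappa>_u: "\<And>t. t < N \<Longrightarrow> \<kappa> (u t) = u (transpose j (Suc j) t)"
begin

sublocale K: field_hom \<kappa> by (rule \<kappa>)

abbreviation "\<sigma> \<equiv> mps_map \<kappa>"
abbreviation "\<tau> \<equiv> transpose j (Suc j)"
abbreviation "\<delta> \<equiv> u j - u (Suc j)"

sublocale R: comm_ring_hom \<sigma> by (rule mps_map_hom[OF \<kappa>])

lemma \<sigma>_cst: "\<sigma> (cst c) = cst (\<kappa> c)"
  by (rule mps_map_cst[OF \<kappa>])

lemma u_ne: "s < N \<Longrightarrow> t < N \<Longrightarrow> s \<noteq> t \<Longrightarrow> u s \<noteq> u t"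
  using inj_u by (auto dest: inj_onD)

lemma \<kappa>_hset:
  assumes "A \<subseteq> {..<N}"
  shows "\<kappa> (hset m (u ` A)) = hset m (u ` \<tau> ` A)"
proof -
  have "finite A" using assms finite_subset by blast
  moreover have "\<kappa> ` u ` A = u ` \<tau> ` A"
    unfolding image_image using assms \<kappa>_u by (intro image_cong) auto
  ultimately show ?thesis using hset_image[OF \<kappa>, of "u ` A"] by simp
qed

lemma \<sigma>_divdiff:
  assumes "A \<subseteq> {..<N}"
  shows "\<sigma> (divdiff u A) = divdiff u (\<tau> ` A)"
proof -
  have fin: "finite A" using assms finite_subset by blast
  have \<tau>: "\<kappa> (u t) = u (\<tau> t)" if "t \<in> A" for t using assms that \<kappa>_u by auto
  have "\<sigma> (divdiff u A) = (\<Sum>t\<in>A. cst (\<Prod>s\<in>A - {t}. inverse (\<kappa> (u s) - \<kappa> (u t))) * Om (1 - \<kappa> (u t)))"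
    by (simp add: divdiff_def R.hom_sum R.hom_mult \<sigma>_cst mps_map_Om[OF \<kappa>] K.hom_prod K.hom_inverse
        K.hom_minus)
  also have "\<dots> = (\<Sum>t\<in>A. cst (\<Prod>s\<in>A - {t}. inverse (u (\<tau> s) - u (\<tau> t))) * Om (1 - u (\<tau> t)))"
    by (intro sum.cong arg_cong2[of _ _ _ _ "(*)"] arg_cong[of _ _ cst] prod.cong) (simp_all add: \<tau>)
  also have "\<dots> = divdiff u (\<tau> ` A)"
  proof -
    have "\<tau> ` A - {\<tau> t} = \<tau> ` (A - {t})" for t
      by (auto simp: image_iff dest: inj_onD[OF inj_transpose])
    then show ?thesis
      by (simp add: divdiff_def sum.reindex prod.reindex inj_on_subset[OF inj_transpose] comp_def)
  qed
  finally show ?thesis .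
qed


lemma divdiff_exchange:
  assumes "A \<subseteq> {..<N}" "j \<notin> A" "Suc j \<notin> A"
  shows "divdiff u (insert (Suc j) A) = divdiff u (insert j A) + cst \<delta> * divdiff u (insert j (insert (Suc j) A))"
proof -
  have "insert j (insert (Suc j) A) \<subseteq> {..<N}" using assms j by auto
  then have "inj_on u (insert j (insert (Suc j) A))" by (rule inj_on_subset[OF inj_u])
  moreover have "finite A" using assms finite_subset by blast
  ultimately have "cst (u (Suc j) - u j) * divdiff u (insert j (insert (Suc j) A)) =
      divdiff u (insert j A) - divdiff u (insert (Suc j) A)"
    using assms by (intro divdiff_rec) simp_all
  then show ?thesis by (simp add: cst_diff algebra_simps)
qed

lemma \<sigma>_divdiff_ivl: "q < N \<Longrightarrow> \<sigma> (divdiff u {p..q}) = divdiff u (\<tau> ` {p..q})"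
  by (rule \<sigma>_divdiff) auto

definition z :: "nat \<Rightarrow> nat \<Rightarrow> mps" where
  "z p q = (if q < p then 0 else divdiff u {p..q})"

lemma \<sigma>_z_same:
  assumes "q < N" "q \<noteq> j" "p \<noteq> Suc j"
  shows "\<sigma> (z p q) = z p q"
proof (cases "q < p")
  case False
  have "\<tau> ` {p..q} = {p..q}" using assms by (intro transpose_image_eq) auto
  then show ?thesis using False assms by (simp add: z_def \<sigma>_divdiff_ivl)
qed (simp add: z_def)

text \<open>For \<open>p \<le> j\<close> the interval \<open>{p..j}\<close> contains just one of the
  exchanged nodes. Replacing it by the other costs \<open>\<delta>\<close> times the divided
  difference at both nodes, which is the entry in the next column.\<close>

lemma \<sigma>_z_col:
  assumes "p \<noteq> Suc j"
  shows "\<sigma> (z p j) = z p j + cst \<delta> * z p (Suc j)"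
proof (cases "j < p")
  case False
  have ivl: "{p..j} = insert j {p..<j}" "{p..Suc j} = insert j (insert (Suc j) {p..<j})" using False by auto
  have "\<tau> ` {p..j} = insert (Suc j) {p..<j}" unfolding ivl by simp
  moreover have "{p..<j} \<subseteq> {..<N}" using j by auto
  ultimately show ?thesis
    using False j divdiff_exchange[of "{p..<j}"] by (simp add: z_def \<sigma>_divdiff_ivl flip: ivl)
qed (use assms in \<open>simp add: z_def\<close>)

text \<open>The right side is a row operation applied after the column operation, hence the extra
  terms at \<open>q = j\<close>. There the left side is 0, and the right side cancels by the
  exchange rule for the nodes \<open>j\<close> and \<open>Suc j\<close>.\<close>

lemma \<sigma>_z_row:
  assumes "q < N"
  shows "\<sigma> (z (Suc j) q) = (z (Suc j) q + (if q = j then cst \<delta> * z (Suc j) (Suc j) else 0))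
    - cst \<delta> * (z j q + (if q = j then cst \<delta> * z j (Suc j) else 0))"
proof (cases "q \<le> j")
  case True
  show ?thesis
  proof (cases "q = j")
    case True
    have "{j..Suc j} = {j, Suc j}" by auto
    then have "z (Suc j) (Suc j) = z j j + cst \<delta> * z j (Suc j)"
      using divdiff_exchange[of "{}"] by (simp add: z_def)
    then show ?thesis using True by (simp add: z_def)
  qed (use True in \<open>simp add: z_def\<close>)
next
  case False
  have ivl: "{Suc j..q} = insert (Suc j) {Suc (Suc j)..q}" "{j..q} = insert j (insert (Suc j) {Suc (Suc j)..q})"
    using False by auto
  have "\<tau> ` {Suc j..q} = insert j {Suc (Suc j)..q}" unfolding ivl by simp
  moreover have "{Suc (Suc j)..q} \<subseteq> {..<N}" using assms by auto
  ultimately have "\<sigma> (divdiff u {Suc j..q}) = divdiff u {Suc j..q} - cst \<delta> * divdiff u {j..q}"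
    using divdiff_exchange[of "{Suc (Suc j)..q}"] unfolding ivl[symmetric] \<sigma>_divdiff_ivl[OF assms]
    by (simp add: ivl)
  then show ?thesis using False by (simp add: z_def)
qed

text \<open>A daggered row in matrix coordinates: \<open>i\<close> is the row index, where the entry
  is 1, and \<open>a\<close> is the first column in which entries may be nonzero.\<close>

definition vrow :: "nat \<Rightarrow> nat \<Rightarrow> nat \<Rightarrow> mps" where
  "vrow a i q = (if a \<le> q \<and> q \<le> i then cst ((- 1) ^ (i - q) * hset (i - q) (u ` {a..q})) else 0)"

text \<open>Within the range of the row, \<open>{a..q}\<close> contains both exchanged indices or
  neither, except at \<open>q = j\<close>, where \<open>hset_exchange\<close> produces the
  correction. So \<open>\<sigma>\<close> acts on such a row by the column operation alone.\<close>

lemma \<sigma>_vrow: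
  assumes "a \<noteq> j" "a \<noteq> Suc j" "q < N"
  shows "\<sigma> (vrow a i q) = vrow a i q + (if q = j then cst \<delta> * vrow a i (Suc j) else 0)"
proof (cases "a \<le> q \<and> q \<le> i")
  case True
  have \<sigma>: "\<sigma> (vrow a i q) = cst ((- 1) ^ (i - q) * hset (i - q) (u ` \<tau> ` {a..q}))"
    using True assms by (simp add: vrow_def \<sigma>_cst K.hom_mult K.hom_power K.hom_uminus \<kappa>_hset subset_eq)
  show ?thesis
  proof (cases "q = j")
    case False
    then have "\<tau> ` {a..q} = {a..q}" using assms True by (intro transpose_image_eq) auto
    then show ?thesis using False True \<sigma> by (simp add: vrow_def)
  next
    case q: True
    then have lt: "a < j" using True assms by simp
    have ivl: "{a..j} = insert j {a..<j}" "{a..Suc j} = insert j (insert (Suc j) {a..<j})"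
      using lt by auto
    have \<tau>: "\<tau> ` {a..j} = insert (Suc j) {a..<j}" unfolding ivl by simp
    show ?thesis
    proof (cases "i - j")
      case 0
      then have "i = j" using True q by simp
      then show ?thesis using \<sigma> q True by (simp add: vrow_def hset_0)
    next
      case (Suc m)
      then have i: "i = Suc (m + j)" by simp
      have notin: "u j \<notin> u ` {a..<j}" "u (Suc j) \<notin> u ` {a..<j}"
        using u_ne j by (auto simp: image_iff)
      have "hset (Suc m) (u ` {a..j}) - hset (Suc m) (u ` insert (Suc j) {a..<j}) = \<delta> * hset m (u ` {a..Suc j})"
        unfolding ivl using notin u_ne[of j "Suc j"] j
        by (simp add: hset_exchange)
      from arg_cong[OF this, of "\<lambda>t. hset (Suc m) (u ` {a..j}) - t"]
      have eq: "hset (Suc m) (u ` insert (Suc j) {a..<j}) = hset (Suc m) (u ` {a..j}) - \<delta> * hset m (u ` {a..Suc j})"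
        by simp
      note \<sigma>
      also have "cst ((- 1) ^ (i - q) * hset (i - q) (u ` \<tau> ` {a..q})) =
          cst ((- 1) ^ Suc m * (hset (Suc m) (u ` {a..j}) - \<delta> * hset m (u ` {a..Suc j})))"
        unfolding q \<tau> Suc eq ..
      also have "\<dots> = cst ((- 1) ^ Suc m * hset (Suc m) (u ` {a..j})) + cst \<delta> * cst ((- 1) ^ m * hset m (u ` {a..Suc j}))"
        unfolding cst_mult[symmetric] cst_add[symmetric] by (rule arg_cong[of _ _ cst]) (simp add: algebra_simps)
      finally show ?thesis using q lt by (simp add: vrow_def i)
    qed
  qed
next
  case False
  then show ?thesis using assms by (auto simp: vrow_def)
qed

text \<open>Moving the start of the row from \<open>Suc j\<close> to \<open>j\<close> is an isobaric
  divided difference of its entries. At \<open>q = j\<close> the image under \<open>\<sigma>\<close>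
  is replaced by the value that the column operation later turns into 0.\<close>

lemma vrow_move:
  assumes "Suc j \<le> i" "q < N"
  shows "cst \<delta> * vrow j i q =
    cst (u j) * (if q = j then - cst \<delta> * \<sigma> (vrow (Suc j) i (Suc j)) else \<sigma> (vrow (Suc j) i q))
    - cst (u (Suc j)) * vrow (Suc j) i q"
proof -
  have \<sigma>: "\<sigma> (vrow (Suc j) i q) = cst ((- 1) ^ (i - q) * hset (i - q) (u ` \<tau> ` {Suc j..q}))"
    if "Suc j \<le> q" "q \<le> i" "q < N" for q
    using that by (simp add: vrow_def \<sigma>_cst K.hom_mult K.hom_power K.hom_uminus \<kappa>_hset subset_eq)
  consider "q < j \<or> q > i" | "q = j" | "Suc j \<le> q" "q \<le> i" by linarith
  then show ?thesis
  proof cases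
    case 1
    then show ?thesis using assms by (auto simp: vrow_def)
  next
    case 2
    obtain m where i: "i = Suc (m + j)" using assms by (metis add.commute add_Suc_right le_Suc_ex)
    have h: "hset (Suc m) {u j} = u j * hset m {u j}"
      using hset_insert[of "{}" "u j" m] by (simp add: hset_empty)
    have "cst \<delta> * vrow j i j = cst (\<delta> * ((- 1) ^ Suc m * (u j * hset m {u j})))"
      by (simp add: vrow_def i h flip: cst_mult)
    also have "\<dots> = cst (u j) * (- cst \<delta> * cst ((- 1) ^ m * hset m {u j}))"
      unfolding cst_mult[symmetric] cst_minus[symmetric] by (rule arg_cong[of _ _ cst]) (simp add: algebra_simps)
    finally show ?thesis using 2 \<sigma>[of "Suc j"] j i by (simp add: vrow_def)
  next
    case 3
    let ?S = "u ` {Suc (Suc j)..q}"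
    have ivl: "{Suc j..q} = insert (Suc j) {Suc (Suc j)..q}" "{j..q} = insert j (insert (Suc j) {Suc (Suc j)..q})"
      using 3 by auto
    have \<tau>: "\<tau> ` {Suc j..q} = insert j {Suc (Suc j)..q}" unfolding ivl by simp
    have notin: "u j \<notin> ?S" "u (Suc j) \<notin> ?S"
      using u_ne assms 3 by (auto simp: image_iff)
    have "\<delta> * hset (i - q) (u ` {j..q}) =
        u j * hset (i - q) (u ` insert j {Suc (Suc j)..q}) - u (Suc j) * hset (i - q) (u ` {Suc j..q})"
      unfolding ivl using notin u_ne[of j "Suc j"] j by (simp add: hset_isobaric)
    then have "\<delta> * (c * hset (i - q) (u ` {j..q})) =
        u j * (c * hset (i - q) (u ` insert j {Suc (Suc j)..q}))
          - u (Suc j) * (c * hset (i - q) (u ` {Suc j..q}))" for c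
      by (simp only: mult.left_commute[of _ c] right_diff_distrib[symmetric])
    then have "cst \<delta> * cst (c * hset (i - q) (u ` {j..q})) =
        cst (u j) * cst (c * hset (i - q) (u ` insert j {Suc (Suc j)..q}))
          - cst (u (Suc j)) * cst (c * hset (i - q) (u ` {Suc j..q}))" for c
      by (simp only: cst_mult[symmetric] cst_diff[symmetric])
    then show ?thesis using 3 \<sigma>[of q] assms
      by (simp add: vrow_def \<tau> del: image_insert)
  qed
qed

end

section \<open>The determinant of a partition\<close>

text \<open>\<open>g s\<close> is the first column of the range of daggered row
  \<open>L + s\<close>. A function in place of a partition makes the addition of a box the update
  \<open>g(s := j)\<close>.\<close>

definition matrix_entry :: "(nat \<Rightarrow> K) \<Rightarrow> nat \<Rightarrow> (nat \<Rightarrow> nat) \<Rightarrow> nat \<Rightarrow> nat \<Rightarrow> mps" where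
  "matrix_entry u L g i q =
    (if i < L then if q < i then 0 else divdiff u {i..q}
     else if g (i - L) \<le> q \<and> q \<le> i
     then cst ((- 1) ^ (i - q) * hset (i - q) (u ` {g (i - L)..q})) else 0)"

definition shape_det :: "(nat \<Rightarrow> K) \<Rightarrow> nat \<Rightarrow> nat \<Rightarrow> (nat \<Rightarrow> nat) \<Rightarrow> mps" where
  "shape_det u L r g = det (mat (L + r) (L + r) (\<lambda>(i, q). matrix_entry u L g i q))"

context adj_swap
begin

text \<open>Up to one column and one row operation, \<open>\<sigma>\<close> maps the matrix
  \<open>A\<close> of \<open>g\<close> to a matrix \<open>D\<close> that differs from
  \<open>A\<close>, and from the matrix \<open>A'\<close> of the new shape, only in row
  \<open>L + s\<close>. The three expansions along this row share their cofactors and are combined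
  by \<open>vrow_move\<close>.\<close>

lemma shape_det_move:
  assumes N: "N = L + r" and s: "s < r" and gs: "g s = Suc j" "Suc j \<le> L + s"
    and below: "\<And>t. t < s \<Longrightarrow> g t < j" and above: "\<And>t. s < t \<Longrightarrow> t < r \<Longrightarrow> Suc j < g t"
  shows "cst \<delta> * shape_det u L r (g(s := j)) = cst (u j) * \<sigma> (shape_det u L r g) - cst (u (Suc j)) * shape_det u L r g"
proof -
  let ?i = "L + s"
  \<comment> \<open>The entry at \<open>j\<close> is chosen so that adding \<open>\<delta>\<close>
    times column \<open>Suc j\<close> yields 0, the value of
    \<open>vrow (Suc j) ?i j\<close>.\<close>
  define w where "w q = (if q = j then - cst \<delta> * \<sigma> (vrow (Suc j) ?i (Suc j)) else \<sigma> (vrow (Suc j) ?i q))" for q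
  define A where "A = mat N N (\<lambda>(i, q). matrix_entry u L g i q)"
  define A' where "A' = mat N N (\<lambda>(i, q). matrix_entry u L (g(s := j)) i q)"
  define D where "D = mat N N (\<lambda>(i, q). if i = ?i then w q else matrix_entry u L g i q)"
  define E where "E = addcol (cst \<delta>) j (Suc j) D"
  \<comment> \<open>The row operation is present only if \<open>Suc j\<close> is the index of an
    undaggered row.\<close>
  define G where "G = (if Suc j < L then addrow (- cst \<delta>) (Suc j) j E else E)"
  have carrier: "A \<in> carrier_mat N N" "A' \<in> carrier_mat N N" "D \<in> carrier_mat N N" "E \<in> carrier_mat N N"
    unfolding A_def A'_def E_def D_def by (auto intro: carrier_matI)
  have z: "matrix_entry u L g i q = z i q" if "i < L" for i q
    using that by (simp add: matrix_entry_def z_def)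
  have v: "matrix_entry u L g i q = vrow (g (i - L)) i q" if "\<not> i < L" for i q
    unfolding matrix_entry_def vrow_def if_not_P[OF that] ..
  have E: "E $$ (i, q) = (if i = ?i then \<sigma> (vrow (Suc j) ?i q)
      else matrix_entry u L g i q + (if q = j then cst \<delta> * matrix_entry u L g i (Suc j) else 0))"
    if "i < N" "q < N" for i q
  proof -
    have "\<sigma> (vrow (Suc j) ?i j) = 0" by (simp add: vrow_def)
    then show ?thesis using that j by (auto simp: E_def D_def w_def)
  qed
  have G: "\<sigma> (matrix_entry u L g i q) = G $$ (i, q)" if i: "i < N" and q: "q < N" for i q
  proof (cases "i < L")
    case True
    show ?thesis
    proof (cases "i = Suc j")
      case i': True
      then show ?thesis using True q j N \<sigma>_z_row[OF q] carrier
        by (simp add: G_def z E[of "Suc j"] E[of j])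
    next
      case False
      then have "G $$ (i, q) = E $$ (i, q)" using i q carrier by (simp add: G_def)
      also have "\<dots> = z i q + (if q = j then cst \<delta> * z i (Suc j) else 0)"
        using True i q by (simp add: E z)
      also have "\<dots> = \<sigma> (z i q)"
        using \<sigma>_z_same[OF q, of i] \<sigma>_z_col[OF False] False by simp
      finally show ?thesis using True by (simp add: z)
    qed
  next
    case False
    then have "G $$ (i, q) = E $$ (i, q)" using i q carrier j N by (auto simp: G_def)
    also have "\<dots> = \<sigma> (vrow (g (i - L)) i q)"
    proof (cases "i = ?i")
      case True
      then show ?thesis using i q by (simp add: E gs)
    next
      case ne: False
      \<comment> \<open>Every other daggered row starts strictly before \<open>j\<close> or strictly
        after \<open>Suc j\<close>, so only the column operation affects it.\<close>
      then have "i - L < s \<or> s < i - L \<and> i - L < r" using i N False by linarith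
      then have "g (i - L) \<noteq> j" "g (i - L) \<noteq> Suc j" using below[of "i - L"] above[of "i - L"] by auto
      then show ?thesis using i q ne False by (simp add: E v \<sigma>_vrow)
    qed
    finally show ?thesis using False by (simp add: v)
  qed
  have "map_mat \<sigma> A = G"
    by (rule eq_matI) (use carrier G in \<open>auto simp: A_def G_def\<close>)
  then have "\<sigma> (det A) = det G" by (simp flip: R.hom_det)
  also have "\<dots> = det E"
    using carrier j det_addrow[of j N "Suc j" E] by (simp add: G_def)
  also have "\<dots> = det D" unfolding E_def using carrier j by (intro det_addcol[where n = N]) auto
  finally have \<sigma>_det: "\<sigma> (det A) = det D" .
  have i: "?i < N" using N s by simp
  let ?c = "\<lambda>q. cofactor A ?i q"
  have same: "cofactor B ?i q = ?c q" if "B = A' \<or> B = D" for B q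
  proof -
    have "B $$ (i, q) = A $$ (i, q)" if "i < N" "q < N" "i \<noteq> ?i" for i q
    proof -
      have "i < L \<or> i - L \<noteq> s" using that by linarith
      then show ?thesis
        using that \<open>B = A' \<or> B = D\<close> by (auto simp: A_def A'_def D_def matrix_entry_def)
    qed
    moreover have "dim_row B = N" "dim_col B = N" using that carrier by auto
    ultimately have "mat_delete B ?i q = mat_delete A ?i q"
      using carrier(1) by (intro eq_matI) (simp_all add: mat_delete_def)
    then show ?thesis by (simp add: cofactor_def)
  qed
  have rows: "A $$ (?i, q) = vrow (Suc j) ?i q" "A' $$ (?i, q) = vrow j ?i q" "D $$ (?i, q) = w q"
    if "q < N" for q
    using that i gs by (simp_all add: A_def A'_def D_def matrix_entry_def vrow_def)
  have det_A: "det A = (\<Sum>q<N. vrow (Suc j) ?i q * ?c q)"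
    unfolding laplace_expansion_row[OF carrier(1) i] by (intro sum.cong refl) (simp only: rows lessThan_iff)
  have det_A': "det A' = (\<Sum>q<N. vrow j ?i q * ?c q)"
    unfolding laplace_expansion_row[OF carrier(2) i]
    by (intro sum.cong refl) (simp only: rows lessThan_iff same simp_thms)
  have det_D: "det D = (\<Sum>q<N. w q * ?c q)"
    unfolding laplace_expansion_row[OF carrier(3) i]
    by (intro sum.cong refl) (simp only: rows lessThan_iff same simp_thms)
  have "cst \<delta> * det A' = (\<Sum>q<N. cst \<delta> * vrow j ?i q * ?c q)"
    unfolding det_A' sum_distrib_left mult.assoc ..
  also have "\<dots> = (\<Sum>q<N. (cst (u j) * w q - cst (u (Suc j)) * vrow (Suc j) ?i q) * ?c q)"
  proof (rule sum.cong)
    fix q assume "q \<in> {..<N}"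
    then have "cst \<delta> * vrow j ?i q = cst (u j) * w q - cst (u (Suc j)) * vrow (Suc j) ?i q"
      using vrow_move[OF gs(2), of q] by (simp only: w_def lessThan_iff)
    then show "cst \<delta> * vrow j ?i q * ?c q = (cst (u j) * w q - cst (u (Suc j)) * vrow (Suc j) ?i q) * ?c q"
      by (rule arg_cong)
  qed (rule refl)
  also have "\<dots> = cst (u j) * det D - cst (u (Suc j)) * det A"
    unfolding det_A det_D sum_distrib_left mult.assoc left_diff_distrib sum_subtractf ..
  finally show ?thesis unfolding \<sigma>_det[symmetric] unfolding shape_det_def A_def A'_def N .
qed

end

text \<open>For the empty partition each daggered row has its diagonal 1 as its only entry, so the
  matrix is upper triangular.\<close>

lemma shape_det_empty: "shape_det u L r (\<lambda>s. L + s) = (\<Prod>i<L. Om (1 - u i))"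
proof -
  let ?A = "mat (L + r) (L + r) (\<lambda>(i, q). matrix_entry u L (\<lambda>s. L + s) i q)"
  have off: "matrix_entry u L (\<lambda>s. L + s) i q = 0" if "q < i" for i q
  proof (cases "i < L")
    case False
    then have "\<not> (L + (i - L) \<le> q \<and> q \<le> i)" using that by linarith
    then show ?thesis unfolding matrix_entry_def if_not_P[OF False] by (simp only: if_False)
  qed (simp only: matrix_entry_def if_True that)
  have diag: "matrix_entry u L (\<lambda>s. L + s) i i = (if i < L then Om (1 - u i) else 1)" for i
  proof (cases "i < L")
    case False
    then have "L + (i - L) = i" by linarith
    then show ?thesis unfolding matrix_entry_def if_not_P[OF False] by (simp add: hset_0)
  qed (simp add: matrix_entry_def)
  have "det ?A = prod_list (diag_mat ?A)"
    by (rule det_upper_triangular[of _ "L + r"]) (simp_all add: upper_triangular_def off)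
  also have "\<dots> = (\<Prod>i<L + r. ?A $$ (i, i))"
    by (simp add: diag_mat_def prod.list_conv_set_nth atLeast0LessThan)
  also have "\<dots> = (\<Prod>i<L + r. if i < L then Om (1 - u i) else 1)"
    by (rule prod.cong) (simp_all add: diag)
  also have "\<dots> = (\<Prod>i<L. if i < L then Om (1 - u i) else 1)"
    by (rule prod.mono_neutral_right) auto
  finally show ?thesis by (simp add: shape_det_def)
qed

lemma shape_det_cong:
  assumes "\<And>s. s < r \<Longrightarrow> g s = g' s"
  shows "shape_det u L r g = shape_det u L r g'"
proof -
  have "matrix_entry u L g i q = matrix_entry u L g' i q" if "i < L + r" for i q
    using assms[of "i - L"] that by (cases "i < L") (simp_all add: matrix_entry_def)
  then have "mat (L + r) (L + r) (\<lambda>(i, q). matrix_entry u L g i q) = mat (L + r) (L + r) (\<lambda>(i, q). matrix_entry u L g' i q)"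
    by (intro eq_matI) simp_all
  then show ?thesis by (simp add: shape_det_def)
qed

section \<open>Words and charge vectors\<close>

lemma aff_s_involution:
  assumes "2 \<le> n" "i < n"
  shows "aff_s n i (aff_s n i m) = m"
proof -
  \<comment> \<open>The two residue classes moved by \<open>aff_s\<close> are distinct because n is
    at least 2; for \<open>i = n - 1\<close> the second one is 0.\<close>
  have ne: "(int i + 1) mod int n \<noteq> int i"
  proof (cases "Suc i = n")
    case True
    then have "int i + 1 = int n" by simp
    then have "(int i + 1) mod int n = 0" by (simp only: mod_self)
    then show ?thesis using assms True by simp
  qed (use assms in \<open>simp add: mod_pos_pos_trivial\<close>)
  consider "m mod int n = int i" | "m mod int n = (int i + 1) mod int n" "m mod int n \<noteq> int i"
    | "m mod int n \<noteq> int i" "m mod int n \<noteq> (int i + 1) mod int n" by blast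
  then show ?thesis
  proof cases
    case 1
    then have "(m + 1) mod int n = (int i + 1) mod int n" by (metis mod_add_left_eq)
    then show ?thesis using 1 ne by (simp add: aff_s_def)
  next
    case 2
    then have "(m - 1) mod int n = (int i + 1 - 1) mod int n" by (metis mod_diff_left_eq)
    then have "(m - 1) mod int n = int i" using assms by (simp add: mod_pos_pos_trivial)
    then show ?thesis using 2 by (simp add: aff_s_def)
  qed (simp add: aff_s_def)
qed

lemma aff_s_periodic: "aff_s n i (m + int n) = aff_s n i m + int n"
  by (simp add: aff_s_def)

text \<open>\<open>level n w m\<close> is the block of length \<open>n\<close> in which \<open>aff_word n w\<close> finds the preimage of \<open>m\<close>;
  one period of it is the charge vector of the coset of \<open>aff_word n w\<close> modulo the finite group.\<close>

fun level :: "nat \<Rightarrow> nat list \<Rightarrow> int \<Rightarrow> int" where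
  "level n [] m = (m - 1) div int n"
| "level n (i # w) m = level n w (aff_s n i m)"

text \<open>\<open>level\<close> applies the letters in the order that undoes the word, each letter
  being its own inverse.\<close>

lemma level_aff_word:
  assumes "2 \<le> n" "set w \<subseteq> {0..<n}"
  shows "level n w (aff_word n w m) = (m - 1) div int n"
  using assms(2) by (induction w) (simp_all add: aff_word_def aff_s_involution[OF assms(1)])

lemma surj_aff_word:
  assumes "2 \<le> n" "set w \<subseteq> {0..<n}"
  shows "surj (aff_word n w)"
  using assms(2)
proof (induction w)
  case (Cons i w)
  have "surj (aff_s n i)"
    using Cons.prems aff_s_involution[OF assms(1), of i] by (metis atLeastLessThan_iff list.set_intros(1) subsetD surj_def)
  then have "surj (aff_s n i \<circ> aff_word n w)" using Cons by (intro comp_surj) simp_all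
  then show ?case by (simp add: aff_word_def)
qed (simp add: aff_word_def)

text \<open>As affine words act surjectively, \<open>level\<close> is an invariant of the affine
  permutation; the charges of an unspecified reduced word can thus be read off from the box
  word.\<close>

lemma level_cong:
  assumes "2 \<le> n" "set w \<subseteq> {0..<n}" "set w' \<subseteq> {0..<n}" "aff_word n w = aff_word n w'"
  shows "level n w = level n w'"
proof
  fix m
  obtain m' where "m = aff_word n w m'" using surj_aff_word[OF assms(1,2)] by blast
  then show "level n w m = level n w' m" using assms level_aff_word by metis
qed

lemma level_periodic:
  assumes "0 < n"
  shows "level n w (m + int n) = level n w m + 1"
proof (induction w arbitrary: m)
  case Nil
  have "m + int n - 1 = (m - 1) + int n" by simp
  then show ?case using assms by (simp only: level.simps div_add_self2)
qed (simp add: aff_s_periodic)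

lemma level_double:
  assumes "2 \<le> n" "i < n"
  shows "level n (i # i # w) = level n w"
  by (rule ext) (simp add: aff_s_involution[OF assms])

section \<open>Inversion counts of charge vectors\<close>

definition phi :: "int \<Rightarrow> int" where
  "phi t = (if 0 \<le> t then t else - t - 1)"

lemma phi_flip: "phi (- t - 1) = phi t"
  by (simp add: phi_def)

text \<open>The number of inversions of the minimal coset representative with charge vector \<open>e\<close>.\<close>

definition inv_count :: "nat \<Rightarrow> (nat \<Rightarrow> int) \<Rightarrow> int" where
  "inv_count n e = (\<Sum>(a, b)\<in>{(a, b). a < b \<and> b < n}. phi (e a - e b))"

lemma finite_pairs: "finite {(a, b). a < b \<and> b < (n :: nat)}"
  by (rule finite_subset[of _ "{..<n} \<times> {..<n}"]) auto

lemma inv_count_cong: "(\<And>k. k < n \<Longrightarrow> e k = e' k) \<Longrightarrow> inv_count n e = inv_count n e'"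
  unfolding inv_count_def by (rule sum.cong) auto

text \<open>The transposition permutes all pairs other than \<open>(j, Suc j)\<close> and keeps
  their order, so only this pair contributes to the difference.\<close>

lemma inv_count_swap:
  assumes j: "Suc j < n" and e': "\<And>k. k < n \<Longrightarrow> e' k = e (transpose j (Suc j) k)"
  shows "inv_count n e' = inv_count n e + phi (e (Suc j) - e j) - phi (e j - e (Suc j))"
proof -
  let ?\<tau> = "transpose j (Suc j)"
  let ?P = "{(a, b). a < b \<and> b < n}"
  let ?f = "\<lambda>e (a, b). phi (e a - e b)"
  have P: "(j, Suc j) \<in> ?P" using j by simp
  have \<tau>: "?\<tau> a < ?\<tau> b \<and> ?\<tau> b < n" if "a < b" "b < n" "(a, b) \<noteq> (j, Suc j)" for a b
    using that j by (auto simp: transpose_def)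
  have "sum (?f e') (?P - {(j, Suc j)}) = sum (?f e) (?P - {(j, Suc j)})"
  proof (rule sum.reindex_bij_witness[where i = "\<lambda>(a, b). (?\<tau> a, ?\<tau> b)" and j = "\<lambda>(a, b). (?\<tau> a, ?\<tau> b)"])
    fix p assume p: "p \<in> ?P - {(j, Suc j)}"
    then obtain a b where ab: "p = (a, b)" "a < b" "b < n" "(a, b) \<noteq> (j, Suc j)" by auto
    have "(?\<tau> a, ?\<tau> b) \<noteq> (j, Suc j)" using ab by (auto simp: transpose_eq_iff)
    then show "(case p of (a, b) \<Rightarrow> (?\<tau> a, ?\<tau> b)) \<in> ?P - {(j, Suc j)}"
      using \<tau>[OF ab(2-4)] ab(1) by simp
    then show "(case p of (a, b) \<Rightarrow> (?\<tau> a, ?\<tau> b)) \<in> ?P - {(j, Suc j)}" .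
    show "(case case p of (a, b) \<Rightarrow> (?\<tau> a, ?\<tau> b) of (a, b) \<Rightarrow> (?\<tau> a, ?\<tau> b)) = p"
      using ab by simp
    then show "(case case p of (a, b) \<Rightarrow> (?\<tau> a, ?\<tau> b) of (a, b) \<Rightarrow> (?\<tau> a, ?\<tau> b)) = p" .
    show "(case case p of (a, b) \<Rightarrow> (?\<tau> a, ?\<tau> b) of (a, b) \<Rightarrow> phi (e a - e b)) =
        (case p of (a, b) \<Rightarrow> phi (e' a - e' b))"
      using ab by (simp add: e')
  qed
  moreover have "inv_count n e'' = sum (?f e'') (?P - {(j, Suc j)}) + phi (e'' j - e'' (Suc j))" for e''
    unfolding inv_count_def using sum.remove[OF finite_pairs P, of "?f e''"] by simp
  ultimately show ?thesis using e'[of j] e'[of "Suc j"] j by simp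
qed

text \<open>Only the pair \<open>(0, m)\<close> changes its contribution. A pair with just one of
  the two ends is matched with a pair containing the other end, and \<open>phi_flip\<close> absorbs
  the shift by one.\<close>

lemma inv_count_wrap:
  assumes m: "1 \<le> m" and e': "e' m = e 0 + 1" "e' 0 = e m - 1"
    and same: "\<And>k. 0 < k \<Longrightarrow> k < m \<Longrightarrow> e' k = e k"
  shows "inv_count (Suc m) e' = inv_count (Suc m) e + phi (e 0 - e m + 1) - phi (e 0 - e m)"
proof -
  let ?P = "{(a, b). a < b \<and> b < Suc m}"
  let ?f = "\<lambda>e (a, b). phi (e a - e b)"
  \<comment> \<open>For an inner \<open>k\<close> this exchanges the pairs \<open>(0, k)\<close> and
    \<open>(k, m)\<close>.\<close>
  let ?\<psi> = "\<lambda>(a, b). if a = 0 then (b, m) else if b = m then (0, a) else (a, b)"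
  have P: "(0, m) \<in> ?P" using m by simp
  have "sum (?f e') (?P - {(0, m)}) = sum (?f e) (?P - {(0, m)})"
  proof (rule sum.reindex_bij_witness[where i = ?\<psi> and j = ?\<psi>])
    fix p assume "p \<in> ?P - {(0, m)}"
    then obtain a b where ab: "p = (a, b)" "a < b" "b < Suc m" "(a, b) \<noteq> (0, m)" by blast
    show "?\<psi> p \<in> ?P - {(0, m)}" using ab by auto
    then show "?\<psi> p \<in> ?P - {(0, m)}" .
    show "?\<psi> (?\<psi> p) = p" using ab by auto
    then show "?\<psi> (?\<psi> p) = p" .
    show "?f e (?\<psi> p) = ?f e' p"
    proof -
      consider "a = 0" "0 < b" "b < m" | "0 < a" "a < m" "b = m" | "0 < a" "b < m" "a < m"
        using ab by fastforce
      then show ?thesis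
      proof cases
        case 1
        then show ?thesis using ab phi_flip[of "e b - e m"] by (simp add: e' same algebra_simps)
      next
        case 2
        then show ?thesis using ab phi_flip[of "e 0 - e a"] by (simp add: e' same algebra_simps)
      next
        case 3
        then show ?thesis using ab by (simp add: same)
      qed
    qed
  qed
  moreover have "inv_count (Suc m) e'' = sum (?f e'') (?P - {(0, m)}) + phi (e'' 0 - e'' m)" for e''
    unfolding inv_count_def using sum.remove[OF finite_pairs P, of "?f e''"] by simp
  moreover have "phi (e' 0 - e' m) = phi (e 0 - e m + 1)"
    using phi_flip[of "e 0 - e m + 1"] by (simp add: e' algebra_simps)
  ultimately show ?thesis by simp
qed

section \<open>The window of L + r consecutive positions and its charges\<close>

locale window =
  fixes n L r :: nat
  assumes n: "2 \<le> n" and L: "1 \<le> L" and Lr: "L + r \<le> n"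
begin

text \<open>Column \<open>k < L + r\<close> of the determinant stands for the integer position \<open>k + 1 - L\<close>.\<close>

definition pos :: "nat \<Rightarrow> int" where
  "pos k = int k + 1 - int L"

text \<open>The letter exchanging columns \<open>j\<close> and \<open>Suc j\<close>; it is also the
  residue of the box added when some \<open>g s\<close> moves from \<open>Suc j\<close> to
  \<open>j\<close>.\<close>

definition res :: "nat \<Rightarrow> nat" where
  "res j = nat (pos j mod int n)"

lemma res_less: "res j < n"
  using n by (simp add: res_def nat_less_iff)

lemma int_res: "int (res j) = pos j mod int n"
  using n by (simp add: res_def)

lemma pos_mod_eq: "a < n \<Longrightarrow> b < n \<Longrightarrow> pos a mod int n = pos b mod int n \<longleftrightarrow> a = b"
proof
  assume ab: "a < n" "b < n" and "pos a mod int n = pos b mod int n"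
  then have "(pos a + (int L - 1)) mod int n = (pos b + (int L - 1)) mod int n" by (metis mod_add_left_eq)
  then show "a = b" using ab by (simp add: pos_def mod_pos_pos_trivial)
qed simp

lemma res_exists:
  assumes "i < n"
  obtains j where "j < n" "i = res j"
proof
  define q where "q = (int i - 1 + int L) mod int n"
  have q: "0 \<le> q" "q < int n" using n by (simp_all add: q_def)
  show "nat q < n" using q by linarith
  have "pos (nat q) mod int n = (q - (int L - 1)) mod int n" using q by (simp add: pos_def algebra_simps)
  also have "\<dots> = ((int i - 1 + int L) - (int L - 1)) mod int n"
    unfolding q_def by (rule mod_diff_left_eq)
  also have "\<dots> = int i" using assms by (simp add: mod_pos_pos_trivial)
  finally show "i = res (nat q)" by (simp add: res_def)
qed

definition charge :: "nat list \<Rightarrow> nat \<Rightarrow> int" where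
  "charge w k = level n w (pos k)"

lemma charge_swap:
  assumes "Suc j < n" "k < n"
  shows "charge (res j # w) k = charge w (transpose j (Suc j) k)"
proof -
  have 1: "pos k mod int n = int (res j) \<longleftrightarrow> k = j"
    using assms pos_mod_eq[of k j] by (simp add: int_res)
  have "(int (res j) + 1) mod int n = pos (Suc j) mod int n"
    by (simp add: int_res pos_def mod_simps algebra_simps)
  then have 2: "pos k mod int n = (int (res j) + 1) mod int n \<longleftrightarrow> k = Suc j"
    using assms pos_mod_eq[of k "Suc j"] by simp
  have "pos j + 1 = pos (Suc j)" "pos (Suc j) - 1 = pos j" by (simp_all add: pos_def)
  then have "aff_s n (res j) (pos k) = pos (transpose j (Suc j) k)"
    unfolding aff_s_def 1 2 by (simp add: transpose_def)
  then show ?thesis by (simp add: charge_def)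
qed

text \<open>The position after the last column is \<open>pos 0\<close> one period later, which
  amounts to one unit of charge.\<close>

lemma charge_wrap:
  assumes m: "n = Suc m"
  shows "charge (res m # w) m = charge w 0 + 1"
    and "charge (res m # w) 0 = charge w m - 1"
    and "0 < k \<Longrightarrow> k < m \<Longrightarrow> charge (res m # w) k = charge w k"
proof -
  have 1: "pos k mod int n = int (res m) \<longleftrightarrow> k = m" if "k \<le> m" for k
    unfolding int_res using that m by (intro pos_mod_eq) simp_all
  have p: "pos m + 1 = pos 0 + int n" using m by (simp add: pos_def)
  have "(int (res m) + 1) mod int n = (pos 0 + int n) mod int n"
    unfolding int_res p[symmetric] by (rule mod_add_left_eq)
  then have 2: "pos k mod int n = (int (res m) + 1) mod int n \<longleftrightarrow> k = 0" if "k \<le> m" for k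
    using that m pos_mod_eq[of k 0] by simp
  have q: "level n w (pos m) = level n w (pos 0 - 1) + 1"
  proof -
    have "pos m = pos 0 - 1 + int n" using p by simp
    then show ?thesis using level_periodic[of n w "pos 0 - 1"] n by simp
  qed
  have "m \<noteq> 0" using n m by simp
  have "charge (res m # w) m = level n w (pos m + 1)"
    using 1[of m] by (simp add: charge_def aff_s_def)
  then show "charge (res m # w) m = charge w 0 + 1"
    unfolding p using level_periodic[of n w "pos 0"] n by (simp add: charge_def)
  show "charge (res m # w) 0 = charge w m - 1"
    using 1[of 0] 2[of 0] \<open>m \<noteq> 0\<close> q by (simp add: charge_def aff_s_def)
  show "charge (res m # w) k = charge w k" if "0 < k" "k < m"
    using 1[of k] 2[of k] that by (simp add: charge_def aff_s_def)
qed

text \<open>The first \<open>L\<close> columns are the positions \<open>1 - L\<close> to 0, which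
  lie in the block before \<open>{1..n}\<close>.\<close>

lemma charge_Nil: "k < n \<Longrightarrow> charge [] k = (if k < L then - 1 else 0)"
proof -
  assume k: "k < n"
  show ?thesis
  proof (cases "k < L")
    case True
    have "pos k - 1 = (int k - int L + int n) + (- 1) * int n" by (simp add: pos_def)
    then have "(pos k - 1) div int n = (int k - int L + int n) div int n - 1"
      using n by (simp only: div_mult_self1)
    also have "(int k - int L + int n) div int n = 0" using True k Lr by (intro div_pos_pos_trivial) auto
    finally show ?thesis using True by (simp add: charge_def)
  next
    case False
    then have "(pos k - 1) div int n = 0" using k by (intro div_pos_pos_trivial) (auto simp: pos_def)
    then show ?thesis using False by (simp add: charge_def)
  qed
qed

lemma inv_count_charge_swap:
  assumes "Suc j < n"
  shows "inv_count n (charge (res j # w)) = inv_count n (charge w) + phi (charge w (Suc j) - charge w j) - phi (charge w j - charge w (Suc j))"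
  by (rule inv_count_swap[OF assms]) (rule charge_swap[OF assms])

lemma inv_count_charge_wrap:
  assumes "n = Suc m"
  shows "inv_count n (charge (res m # w)) = inv_count n (charge w) + phi (charge w 0 - charge w m + 1) - phi (charge w 0 - charge w m)"
proof -
  have "1 \<le> m" using n assms by simp
  then show ?thesis using inv_count_wrap[of m "charge (res m # w)" "charge w"] charge_wrap[OF assms] assms by simp
qed

text \<open>The empty word has no inversions, and a letter raises the count by at most one.\<close>

lemma inv_count_charge_le:
  assumes "set w \<subseteq> {0..<n}"
  shows "inv_count n (charge w) \<le> int (length w)"
  using assms
proof (induction w)
  case Nil
  have "inv_count n (charge []) = (\<Sum>p\<in>{(a, b). a < b \<and> b < n}. 0)"
    unfolding inv_count_def by (rule sum.cong) (auto simp: charge_Nil phi_def)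
  then show ?case by simp
next
  case (Cons i w)
  then obtain j where j: "j < n" "i = res j" using res_exists[of i] by auto
  consider "Suc j < n" | "n = Suc j" using j by linarith
  then have "inv_count n (charge (i # w)) \<le> inv_count n (charge w) + 1"
    using inv_count_charge_swap[of j w] inv_count_charge_wrap[of j w] j(2) by cases (auto simp: phi_def)
  then show ?case using Cons by simp
qed

text \<open>A partition \<open>\<lambda>\<close> in the \<open>L\<close> times \<open>r\<close> rectangle is recorded by the strictly increasing
  function \<open>g s = L + s - \<lambda>'\<^bsub>s+1\<^esub>\<close>, which lists the columns of charge \<open>0\<close> among the
  first \<open>L + r\<close>.\<close>

definition admissible :: "(nat \<Rightarrow> nat) \<Rightarrow> bool" where
  "admissible g \<longleftrightarrow> (\<forall>s t. s < t \<and> t < r \<longrightarrow> g s < g t) \<and> (\<forall>s<r. g s \<le> L + s)"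

lemma admissible_less: "admissible g \<Longrightarrow> s < t \<Longrightarrow> t < r \<Longrightarrow> g s < g t"
  by (simp add: admissible_def)

lemma admissible_le: "admissible g \<Longrightarrow> s < r \<Longrightarrow> g s \<le> L + s"
  by (simp add: admissible_def)

definition shape_charge :: "(nat \<Rightarrow> nat) \<Rightarrow> nat \<Rightarrow> int" where
  "shape_charge g k = (if k < L + r \<and> k \<notin> g ` {..<r} then - 1 else 0)"

definition fits :: "nat list \<Rightarrow> (nat \<Rightarrow> nat) \<Rightarrow> bool" where
  "fits w g \<longleftrightarrow> set w \<subseteq> {0..<n} \<and> admissible g \<and> (\<forall>k<n. charge w k = shape_charge g k)"

lemma fits_inv_count: "fits w g \<Longrightarrow> inv_count n (charge w) = inv_count n (shape_charge g)"
  by (rule inv_count_cong) (simp add: fits_def)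

lemma shape_charge_move:
  assumes g: "admissible g" and s: "s < r" "g s = Suc j" "j \<notin> g ` {..<r}"
  shows "shape_charge (g(s := j)) k = shape_charge g (transpose j (Suc j) k)"
proof -
  have inj: "g t = g s \<longleftrightarrow> t = s" if "t < r" for t
    using g s that unfolding admissible_def by (metis less_irrefl nat_neq_iff)
  have im: "(g(s := j)) ` {..<r} = insert j (g ` {..<r} - {Suc j})"
    using s inj by (auto simp: image_iff)
  have "Suc j \<in> g ` {..<r}" using s by (metis image_eqI lessThan_iff)
  moreover have "Suc j < L + r" using g s by (auto simp: admissible_def)
  ultimately show ?thesis using s(3) unfolding shape_charge_def im by (auto simp: transpose_def)
qed

text \<open>Adding the box turns the charges -1, 0 in columns \<open>j\<close>, \<open>Suc j\<close>
  into 0, -1; this creates one inversion since \<open>phi 1 = 1\<close> and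
  \<open>phi (- 1) = 0\<close>.\<close>

lemma fits_add:
  assumes w: "fits w g" and s: "s < r" "g s = Suc j" "j \<notin> g ` {..<r}"
  shows "fits (res j # w) (g(s := j))" and "inv_count n (shape_charge (g(s := j))) = inv_count n (shape_charge g) + 1"
proof -
  have g: "admissible g" using w by (simp add: fits_def)
  have j: "Suc j < L + r" using g s by (auto simp: admissible_def)
  then have jn: "Suc j < n" using Lr by simp
  have lt: "g t < j" if "t < s" for t
  proof -
    have "g t < Suc j" using admissible_less[OF g that s(1)] s(2) by simp
    moreover have "g t \<noteq> j" using s that by auto
    ultimately show ?thesis by simp
  qed
  moreover have "j < g t" if "s < t" "t < r" for t
    using admissible_less[OF g that] s(2) by simp
  moreover have "j \<le> L + s" using admissible_le[OF g s(1)] s(2) by simp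
  ultimately have "admissible (g(s := j))"
    using g by (simp add: admissible_def)
  moreover have "charge (res j # w) k = shape_charge (g(s := j)) k" if "k < n" for k
  proof -
    have "transpose j (Suc j) k < n" using that jn by (auto simp: transpose_def)
    then show ?thesis using w shape_charge_move[OF g s] charge_swap[OF jn that] by (simp add: fits_def)
  qed
  ultimately show fits: "fits (res j # w) (g(s := j))" using w res_less by (simp add: fits_def)
  have "shape_charge g j = - 1" "shape_charge g (Suc j) = 0"
    using s j by (auto simp: shape_charge_def) (metis image_eqI lessThan_iff)
  then have "charge w j = - 1" "charge w (Suc j) = 0" using w jn by (auto simp: fits_def)
  then show "inv_count n (shape_charge (g(s := j))) = inv_count n (shape_charge g) + 1"
    using inv_count_charge_swap[OF jn, of w] fits_inv_count[OF fits] fits_inv_count[OF w] by (simp add: phi_def)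
qed

text \<open>The inversion count bounds the length of a word from below, so the first letter of a
  shortest word must lower it.\<close>

lemma fits_remove:
  assumes fits: "fits (i # w) g" and le: "int (length (i # w)) \<le> inv_count n (shape_charge g)"
  obtains s j where "s < r" "g s = j" "Suc j < L + r" "i = res j" "Suc j \<notin> g ` {..<r}" "Suc j \<le> L + s"
    "fits w (g(s := Suc j))" "int (length w) \<le> inv_count n (shape_charge (g(s := Suc j)))"
proof -
  have i: "i < n" and w: "set w \<subseteq> {0..<n}" and g: "admissible g" using fits by (auto simp: fits_def)
  obtain j where j: "j < n" "i = res j" using res_exists[OF i] .
  \<comment> \<open>Applying the letter twice recovers \<open>w\<close>, so the formulas for a new
    letter, applied to \<open>i # w\<close>, describe the removal of its first letter.\<close>
  have twice: "charge (res j # i # w) = charge w"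
    using level_double[OF n i] j by (simp add: charge_def fun_eq_iff)
  have len_w: "inv_count n (charge w) < inv_count n (charge (i # w))"
    using inv_count_charge_le[OF w] le fits_inv_count[OF fits] by simp
  have val: "charge (i # w) k = shape_charge g k" if "k < n" for k using fits that by (simp add: fits_def)
  have two: "shape_charge g k = 0 \<or> shape_charge g k = - 1" for k by (simp add: shape_charge_def)
  have "Suc j < n \<and> shape_charge g j = 0 \<and> shape_charge g (Suc j) = - 1"
  proof (cases "Suc j < n")
    case True
    have "phi (shape_charge g (Suc j) - shape_charge g j) < phi (shape_charge g j - shape_charge g (Suc j))"
      using len_w inv_count_charge_swap[OF True, of "i # w"] val[of j] val[of "Suc j"] j True unfolding twice by simp
    then show ?thesis using True two[of j] two[of "Suc j"] by (auto simp: phi_def)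
  next
    case False
    then have "n = Suc j" using j by simp
    then have "phi (shape_charge g 0 - shape_charge g j + 1) < phi (shape_charge g 0 - shape_charge g j)"
      using len_w inv_count_charge_wrap[of j "i # w"] val[of 0] val[of j] n unfolding twice by simp
    \<comment> \<open>The wrap-around letter could lower the count only if the charges at the two
      ends differed by at least 2, but they are all 0 or -1.\<close>
    then show ?thesis using two[of 0] two[of j] by (auto simp: phi_def)
  qed
  then have jn: "Suc j < n" and desc: "shape_charge g j = 0" "shape_charge g (Suc j) = - 1" by auto
  have Sj: "Suc j < L + r" "Suc j \<notin> g ` {..<r}" using desc(2) by (auto simp: shape_charge_def split: if_splits)
  then have "j \<in> g ` {..<r}" using desc(1) by (auto simp: shape_charge_def split: if_splits)
  then obtain s where s: "s < r" "g s = j" by auto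
  let ?g = "g(s := Suc j)"
  have gt: "Suc j < g t" if "s < t" "t < r" for t
  proof -
    have "j < g t" using admissible_less[OF g that] s(2) by simp
    moreover have "g t \<noteq> Suc j" using Sj(2) that(2) by (metis image_eqI lessThan_iff)
    ultimately show ?thesis by simp
  qed
  \<comment> \<open>If \<open>g s\<close> were already at its bound, the next value would have to
    exceed \<open>Suc j = L + Suc s\<close>, which is the bound for \<open>Suc s\<close>.\<close>
  have lo: "g s < L + s"
  proof (rule ccontr)
    assume "\<not> g s < L + s"
    then have eq: "j = L + s" using admissible_le[OF g s(1)] s(2) by simp
    then have "Suc s < r" using Sj by simp
    then have "Suc j < g (Suc s)" "g (Suc s) \<le> L + Suc s" using gt admissible_le[OF g, of "Suc s"] by auto
    then show False using eq by simp
  qed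
  have adm: "admissible ?g"
    using g s gt lo unfolding admissible_def by (auto intro: less_SucI)
  have g_eq: "?g(s := j) = g" using s by auto
  have notin: "j \<notin> ?g ` {..<r}"
  proof
    assume "j \<in> ?g ` {..<r}"
    then obtain t where t: "t < r" "?g t = j" by auto
    then have "t \<noteq> s" "g t = g s" using s by (auto split: if_splits)
    then show False using g t(1) s unfolding admissible_def by (metis less_irrefl nat_neq_iff)
  qed
  have "charge w k = shape_charge ?g k" if "k < n" for k
  proof -
    have \<tau>: "transpose j (Suc j) k < n" using that jn by (auto simp: transpose_def)
    have "charge w k = charge (i # w) (transpose j (Suc j) k)" using charge_swap[OF jn that, of "i # w"] unfolding twice .
    also have "\<dots> = shape_charge (?g(s := j)) (transpose j (Suc j) k)" using val[OF \<tau>] g_eq by simp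
    also have "\<dots> = shape_charge ?g k" using shape_charge_move[OF adm s(1) _ notin, of "transpose j (Suc j) k"] by simp
    finally show ?thesis .
  qed
  then have fits': "fits w ?g" using w adm by (simp add: fits_def)
  have "inv_count n (shape_charge (?g(s := j))) = inv_count n (shape_charge ?g) + 1"
    using fits_add(2)[OF fits' s(1) _ notin] by simp
  then have "int (length w) \<le> inv_count n (shape_charge ?g)" using le g_eq by simp
  with s Sj j(2) lo fits' that show thesis by auto
qed

lemma fits_Nil: "fits [] (\<lambda>s. L + s)" and inv_count_Nil: "inv_count n (shape_charge (\<lambda>s. L + s)) = 0"
proof -
  have "charge [] k = shape_charge (\<lambda>s. L + s) k" if "k < n" for k
    using that charge_Nil[OF that] by (auto simp: shape_charge_def image_iff) (metis le_add_diff_inverse less_diff_conv2 lessThan_iff linorder_not_less add.commute)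
  then show fits: "fits [] (\<lambda>s. L + s)" by (simp add: fits_def admissible_def)
  have "inv_count n (charge []) = (\<Sum>p\<in>{(a, b). a < b \<and> b < n}. 0)"
    unfolding inv_count_def by (rule sum.cong) (auto simp: charge_Nil phi_def)
  then show "inv_count n (shape_charge (\<lambda>s. L + s)) = 0" using fits_inv_count[OF fits] by simp
qed

text \<open>The charges -1 in the first \<open>L\<close> columns force all values of
  \<open>g\<close> to be at least \<open>L\<close>; strict growth then meets the upper bound
  \<open>L + s\<close>.\<close>

lemma fits_Nil_unique:
  assumes "fits [] g" "s < r"
  shows "g s = L + s"
proof -
  have g: "admissible g" using assms by (simp add: fits_def)
  have ge: "L \<le> g t" if "t < r" for t
  proof (rule ccontr)
    assume "\<not> L \<le> g t"
    then have lt: "g t < L" by simp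
    then have "charge [] (g t) = - 1" using charge_Nil[of "g t"] Lr by simp
    moreover have "shape_charge g (g t) = 0" using that by (simp add: shape_charge_def)
    moreover have "g t < n" using lt Lr by simp
    ultimately show False using assms(1) by (simp add: fits_def)
  qed
  have "L + s \<le> g s" using assms(2)
  proof (induction s)
    case (Suc s)
    then have "g s < g (Suc s)" using g by (simp add: admissible_def)
    then show ?case using Suc by simp
  qed (use ge in simp)
  then show ?thesis using g assms(2) by (simp add: admissible_def order_antisym)
qed

section \<open>The row reading word of a partition\<close>

definition shape :: "nat list \<Rightarrow> nat \<Rightarrow> nat" where
  "shape lam s = L + s - Defs.conj lam (Suc s)"

lemma conj_append: "Defs.conj (lam @ [c]) j = Defs.conj lam j + (if j \<le> c then 1 else 0)"
  by (simp add: Defs.conj_def)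

lemma conj_full: "\<forall>x\<in>set lam. j \<le> x \<Longrightarrow> Defs.conj lam j = length lam"
  by (simp add: Defs.conj_def)

lemma box_word_snoc:
  "box_word n (lam @ [c]) =
    rev (map (\<lambda>k. nat ((int k - int (Suc (length lam))) mod int n)) [1..<c + 1]) @ box_word n lam"
proof -
  have "map (\<lambda>rr. map (\<lambda>k. nat ((int k - int rr) mod int n)) [1..<(lam @ [c]) ! (rr - 1) + 1]) [1..<length lam + 1]
    = map (\<lambda>rr. map (\<lambda>k. nat ((int k - int rr) mod int n)) [1..<lam ! (rr - 1) + 1]) [1..<length lam + 1]"
    by (rule map_cong) (auto simp: nth_append)
  moreover have "[1..<length (lam @ [c]) + 1] = [1..<length lam + 1] @ [Suc (length lam)]" by simp
  ultimately show ?thesis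
    unfolding box_word_def by (simp only: map_append concat_append rev_append) simp
qed

lemma box_word_snoc_0: "box_word n (lam @ [0]) = box_word n lam"
  by (simp add: box_word_snoc)

lemma box_word_snoc_Suc:
  assumes "length lam < L"
  shows "box_word n (lam @ [Suc c]) = res (c + L - 1 - length lam) # box_word n (lam @ [c])"
proof -
  \<comment> \<open>The new box has row \<open>length lam + 1\<close> and column
    \<open>c + 1\<close>; its content is the position of the stated column.\<close>
  have "int (Suc c) - int (Suc (length lam)) = pos (c + L - 1 - length lam)"
    using assms by (simp add: pos_def of_nat_diff)
  then show ?thesis by (simp add: box_word_snoc res_def)
qed

text \<open>Induction over the rows and, within the last row, over its boxes; lists with a trailing
  0 serve as intermediate stages. Each box adds one letter and one inversion, so the box word
  attains the lower bound for the length.\<close>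

lemma fits_box_word:
  assumes "sorted_wrt (\<ge>) lam" "length lam \<le> L" "\<forall>x\<in>set lam. x \<le> r"
  shows "fits (box_word n lam) (shape lam) \<and> int (length (box_word n lam)) = inv_count n (shape_charge (shape lam))"
  using assms
proof (induction lam rule: rev_induct)
  case Nil
  have "shape [] = (\<lambda>s. L + s)" by (simp add: shape_def Defs.conj_def fun_eq_iff)
  then show ?case using fits_Nil inv_count_Nil by (simp add: box_word_def)
next
  case (snoc c lam)
  have lam: "\<forall>x\<in>set lam. c \<le> x" "length lam < L" "c \<le> r"
    using snoc.prems by (auto simp: sorted_wrt_append)
  have IH: "fits (box_word n lam) (shape lam) \<and> int (length (box_word n lam)) = inv_count n (shape_charge (shape lam))"
    using snoc by (simp add: sorted_wrt_append)
  show ?case using lam(1,3)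
  proof (induction c)
    case 0
    have "shape (lam @ [0]) = shape lam" by (simp add: shape_def conj_append fun_eq_iff)
    then show ?case using IH by (simp add: box_word_snoc_0)
  next
    case (Suc c)
    let ?g = "shape (lam @ [c])" and ?j = "c + L - 1 - length lam"
    have IHc: "fits (box_word n (lam @ [c])) ?g"
      "int (length (box_word n (lam @ [c]))) = inv_count n (shape_charge ?g)"
      using Suc by (auto simp: Suc_le_eq less_imp_le)
    have full: "Defs.conj lam (Suc s) = length lam" if "s \<le> c" for s
      using Suc.prems that by (intro conj_full) auto
    have gc: "?g c = Suc ?j" using lam(2) full[of c, simplified] by (simp add: shape_def conj_append)
    \<comment> \<open>Columns before \<open>c\<close> already contain the new row and have values
      below \<open>?j\<close>; those after \<open>c\<close> have values above
      \<open>?g c = Suc ?j\<close>.\<close>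
    have notin: "?j \<notin> ?g ` {..<r}"
    proof
      assume "?j \<in> ?g ` {..<r}"
      then obtain t where t: "t < r" "?g t = ?j" by auto
      consider "t < c" | "t = c" | "c < t" by linarith
      then show False
      proof cases
        case 1
        then show False using t lam(2) full[of t] by (simp add: shape_def conj_append)
      next
        case 2
        then show False using t gc by simp
      next
        case 3
        have "admissible ?g" using IHc(1) by (simp add: fits_def)
        then have "?g c < ?g t" using admissible_less 3 t(1) by blast
        then show False using gc t by simp
      qed
    qed
    have sh: "shape (lam @ [Suc c]) = ?g(c := ?j)"
      using lam(2) full[of c] by (auto simp: shape_def conj_append fun_eq_iff)
    have "c < r" using Suc.prems by simp
    note add = fits_add[OF IHc(1) this gc notin]
    have "int (length (k # w)) = int (length w) + 1" for k and w :: "nat list" by simp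
    then show ?case
      unfolding sh box_word_snoc_Suc[OF lam(2)] add(2) IHc(2)[symmetric] using add(1) by blast
  qed
qed

end

section \<open>Demazure operators and determinants\<close>

context window
begin

definition u :: "nat \<Rightarrow> K" where
  "u k = inverse (ea n (pos k))"

lemma u_nonzero [simp]: "u k \<noteq> 0"
  by (simp add: u_def)

lemma inj_u: "inj_on u {..<n}"
  by (rule inj_onI) (simp add: u_def ea_eq_iff[OF n] pos_mod_eq)

definition res_perm :: "nat \<Rightarrow> nat \<Rightarrow> nat" where
  "res_perm i = (if i = 0 then swapf 1 n else swapf i (i + 1))"

lemma res_perm_hom:
  assumes "i < n"
  shows "field_hom (kperm n (res_perm i))" and "kperm n (res_perm i) (ea n p) = ea n (int (res_perm i (idx n p)))"
proof -
  have "res_perm i permutes {1..n}" using assms n by (auto simp: res_perm_def swapf_eq intro!: permutes_swap_id)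
  moreover have "res_perm i (res_perm i t) = t" for t by (simp add: res_perm_def swapf_eq)
  moreover have "0 < n" using n by simp
  ultimately show "field_hom (kperm n (res_perm i))" "kperm n (res_perm i) (ea n p) = ea n (int (res_perm i (idx n p)))"
    by (blast intro: kperm_field_hom)+
qed

lemma res_perm_u:
  assumes j: "Suc j < n" and k: "k < n"
  shows "kperm n (res_perm (res j)) (u k) = u (transpose j (Suc j) k)"
proof -
  interpret field_hom "kperm n (res_perm (res j))" by (rule res_perm_hom(1)[OF res_less])
  \<comment> \<open>These are the representatives in \<open>{1..n}\<close> of \<open>pos j\<close>
    and \<open>pos (Suc j)\<close> modulo n; for residue 0 they are n and 1.\<close>
  define a b where "a = (if res j = 0 then n else res j)" and "b = (if res j = 0 then 1 else res j + 1)"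
  have res_perm: "res_perm (res j) = transpose a b"
    by (simp add: res_perm_def swapf_eq a_def b_def transpose_commute)
  have ab: "1 \<le> a" "a \<le> n" "1 \<le> b" "b \<le> n" using res_less[of j] n by (auto simp: a_def b_def)
  have "int a mod int n = int (res j) mod int n" by (simp add: a_def)
  then have a: "int a mod int n = pos j mod int n" by (simp add: int_res)
  have "int b mod int n = (int (res j) + 1) mod int n" by (simp add: b_def add.commute)
  also have "\<dots> = (pos j + 1) mod int n" by (simp add: int_res mod_simps)
  also have "pos j + 1 = pos (Suc j)" by (simp add: pos_def)
  finally have b: "int b mod int n = pos (Suc j) mod int n" .
  have "idx n (pos k) = a \<longleftrightarrow> k = j" "idx n (pos k) = b \<longleftrightarrow> k = Suc j"
    using idx_eq_iff[OF ab(1,2)] idx_eq_iff[OF ab(3,4)] a b pos_mod_eq[of k] j k by auto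
  moreover have "int (idx n (pos k)) mod int n = pos k mod int n"
    using idx_eq_iff[of "idx n (pos k)" n "pos k"] idx_bounds[of n "pos k"] n by simp
  ultimately have "int (res_perm (res j) (idx n (pos k))) mod int n = pos (transpose j (Suc j) k) mod int n"
    unfolding res_perm using a b by (auto simp: transpose_def)
  then have "ea n (int (res_perm (res j) (idx n (pos k)))) = ea n (pos (transpose j (Suc j) k))"
    using ea_eq_iff[OF n] by blast
  then show ?thesis by (simp add: u_def hom_inverse res_perm_hom(2)[OF res_less])
qed

lemma adj_swap_res:
  assumes "Suc j < L + r"
  shows "adj_swap (kperm n (res_perm (res j))) u (L + r) j"
proof (rule adj_swap.intro)
  show "inj_on u {..<L + r}" using inj_u Lr by (auto intro: inj_on_subset)
qed (use assms Lr res_perm_hom(1)[OF res_less, of j] res_perm_u in simp_all)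

definition Xi :: mps where
  "Xi = (\<Prod>k<L. Om (1 - u k))"

lemma Mps_inv_Om: "Mps (ps_inv (Omega b)) * Om b = 1"
proof -
  obtain g where "g * Om b = 1" using Omega_unit by blast
  then show ?thesis using Mps_inv[of g "Omega b"] by (simp add: Om_def)
qed

lemma Xi_unit: "\<exists>V. V * Xi = 1"
proof
  show "(\<Prod>k<L. Mps (ps_inv (Omega (1 - u k)))) * Xi = 1"
    by (simp add: Xi_def Mps_inv_Om flip: prod.distrib)
qed

text \<open>Within the window the twisted operator \<open>s_0\<close> exchanges positions 0 and 1,
  that is, the last column contributing to \<open>Xi\<close> with the next one.\<close>

lemma res_0:
  assumes "Suc j < L + r"
  shows "res j = 0 \<longleftrightarrow> Suc j = L"
proof
  assume "res j = 0"
  then have "pos j mod int n = pos (L - 1) mod int n" using int_res[of j] L by (simp add: pos_def)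
  then show "Suc j = L" using pos_mod_eq[of j "L - 1"] assms Lr L by simp
qed (auto simp: res_def pos_def)

text \<open>For a nonzero residue the exchange permutes the factors of \<open>Xi\<close>. For
  residue 0 it replaces the factor of \<open>b_n\<close> by that of \<open>b_1\<close>, which is
  exactly the twist in \<open>s_0\<close>.\<close>

lemma s_op_Xi:
  assumes j: "Suc j < L + r"
  shows "Mps (s_op n (res j) f) * Xi = mps_map (kperm n (res_perm (res j))) (Mps f * Xi)"
proof -
  interpret adj_swap "kperm n (res_perm (res j))" u "L + r" j by (rule adj_swap_res[OF j])
  have \<sigma>_Om: "\<sigma> (Om (1 - u k)) = Om (1 - u (\<tau> k))" if "k < L" for k
    using \<kappa>_u[of k] that by (simp add: mps_map_Om[OF \<kappa>] K.hom_minus)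
  show ?thesis
  proof (cases "res j = 0")
    case False
    have "Suc j \<noteq> L" using False res_0[OF j] by simp
    then have "\<tau> ` {..<L} = {..<L}" by (intro transpose_image_eq) auto
    then have "Xi = (\<Prod>k<L. Om (1 - u (\<tau> k)))"
      using prod.reindex[of \<tau> "{..<L}" "\<lambda>k. Om (1 - u k)"] by (simp add: Xi_def)
    moreover have "\<sigma> Xi = (\<Prod>k<L. Om (1 - u (\<tau> k)))"
      by (simp add: Xi_def R.hom_prod \<sigma>_Om cong: prod.cong_simp)
    ultimately have "\<sigma> Xi = Xi" by simp
    moreover have "Mps (s_op n (res j) f) = \<sigma> (Mps f)"
      using False by (simp add: s_op_def Mps_perm res_perm_def)
    ultimately show ?thesis by (simp add: R.hom_mult)
  next
    case True
    then have j_L: "Suc j = L" using res_0[OF j] by simp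
    then have ivl: "{..<L} = insert j {..<j}" and pos: "pos j = 0" "pos (Suc j) = 1"
      by (auto simp: pos_def)
    define P where "P = (\<Prod>k<j. Om (1 - u k))"
    have Xi: "Xi = P * Om (1 - u j)" by (simp add: Xi_def P_def ivl mult.commute)
    have "\<sigma> Xi = P * Om (1 - u (Suc j))"
      unfolding Xi R.hom_mult P_def R.hom_prod using \<sigma>_Om j_L by simp
    moreover have "u (Suc j) = inverse (ea n 1)" by (simp add: u_def pos)
    moreover have "u j = inverse (ea n (int n))"
      using ea_eq_iff[OF n, of 0 "int n"] by (simp add: u_def pos)
    ultimately have "\<sigma> Xi = P * Om (bb n 1)" "Xi = P * Om (bb n (int n))"
      using Xi by (simp_all add: bb_def)
    moreover have "Mps (s_op n (res j) f) = Om (bb n 1) * Mps (ps_inv (Omega (bb n (int n)))) * \<sigma> (Mps f)"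
      by (simp add: s_op_def True Mps_mult Mps_perm res_perm_def Om_def)
    ultimately show ?thesis
      using Mps_inv_Om[of "bb n (int n)"] unfolding R.hom_mult
      by (metis (no_types, lifting) mult.assoc mult.commute mult_1)
  qed
qed

text \<open>Since \<open>ealpha n (res j)\<close> is the quotient of \<open>u (Suc j)\<close> by
  \<open>u j\<close>, the denominator of \<open>T_i\<close> is \<open>\<delta> / u j\<close>;
  multiplication by \<open>\<delta>\<close> clears it.\<close>

lemma D_op_Xi:
  assumes j: "Suc j < L + r"
  shows "cst (u j - u (Suc j)) * (Mps (D_op n (res j) f) * Xi) =
    cst (u j) * mps_map (kperm n (res_perm (res j))) (Mps f * Xi) - cst (u (Suc j)) * (Mps f * Xi)"
proof -
  interpret adj_swap "kperm n (res_perm (res j))" u "L + r" j by (rule adj_swap_res[OF j])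
  have \<delta>: "\<delta> \<noteq> 0" using u_ne[of j "Suc j"] j by simp
  have "ealpha n (res j) = u (Suc j) * inverse (u j)"
  proof (cases "res j = 0")
    case True
    then have "pos j = 0" "pos (Suc j) = 1" using res_0[OF j] by (auto simp: pos_def)
    then show ?thesis using True ea_eq_iff[OF n, of 0 "int n"] by (simp add: ealpha_def u_def)
  next
    case False
    have "ea n (int (res j)) = ea n (pos j)" "ea n (int (res j) + 1) = ea n (pos (Suc j))"
      using ea_eq_iff[OF n] by (simp_all add: int_res pos_def mod_simps algebra_simps)
    then show ?thesis using False by (simp add: ealpha_def u_def mult.commute)
  qed
  then have "1 - ealpha n (res j) = \<delta> / u j" by (simp add: field_simps)
  then have "inverse (1 - ealpha n (res j)) = u j / \<delta>" by simp
  then have "cst \<delta> * Mps (D_op n (res j) f) =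
      cst \<delta> * (cst (u j / \<delta>) * (Mps (s_op n (res j) f) - Mps f) + Mps f)"
    by (simp add: D_op_def T_op_def Mps_add Mps_smult Mps_diff)
  also have "\<dots> = cst (\<delta> * (u j / \<delta>)) * (Mps (s_op n (res j) f) - Mps f) + cst \<delta> * Mps f"
    by (simp only: distrib_left cst_mult mult.assoc)
  also have "\<delta> * (u j / \<delta>) = u j" using \<delta> by simp
  also have "cst (u j) * (Mps (s_op n (res j) f) - Mps f) + cst \<delta> * Mps f =
      cst (u j) * Mps (s_op n (res j) f) - cst (u (Suc j)) * Mps f"
    by (simp add: cst_diff algebra_simps)
  finally have "cst \<delta> * Mps (D_op n (res j) f) * Xi =
      cst (u j) * (Mps (s_op n (res j) f) * Xi) - cst (u (Suc j)) * (Mps f * Xi)"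
    by (simp only: left_diff_distrib mult.assoc)
  then show ?thesis by (simp only: s_op_Xi[OF j] mult.assoc)
qed

text \<open>By the length hypothesis the first letter adds a box to the shape of the remaining word.
  \<open>D_op_Xi\<close> and \<open>shape_det_move\<close> then have the same right side, and the
  nonzero \<open>\<delta>\<close> cancels.\<close>

lemma D_word_eq_shape_det:
  assumes "fits w g" "int (length w) \<le> inv_count n (shape_charge g)"
  shows "Mps (D_word n w ps_one) * Xi = shape_det u L r g"
  using assms
proof (induction w arbitrary: g)
  case Nil
  have "shape_det u L r g = shape_det u L r (\<lambda>s. L + s)" by (rule shape_det_cong) (rule fits_Nil_unique[OF Nil(1)])
  then show ?case by (simp add: D_word_def Mps_one shape_det_empty Xi_def)
next
  case (Cons i w)
  obtain s j where sj: "s < r" "g s = j" "Suc j < L + r" "i = res j" "Suc j \<notin> g ` {..<r}" "Suc j \<le> L + s"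
    and fits: "fits w (g(s := Suc j))" and inv_count: "int (length w) \<le> inv_count n (shape_charge (g(s := Suc j)))"
    using fits_remove[OF Cons.prems] .
  let ?g = "g(s := Suc j)"
  interpret adj_swap "kperm n (res_perm (res j))" u "L + r" j by (rule adj_swap_res[OF sj(3)])
  have adm: "admissible ?g" "admissible g" using fits Cons.prems by (simp_all add: fits_def)
  have "cst \<delta> * shape_det u L r (?g(s := j)) = cst (u j) * \<sigma> (shape_det u L r ?g) - cst (u (Suc j)) * shape_det u L r ?g"
  proof (rule shape_det_move[OF refl sj(1)])
    show "?g t < j" if "t < s" for t
      using admissible_less[OF adm(2) that sj(1)] that sj(2) by simp
    show "Suc j < ?g t" if "s < t" "t < r" for t
      using admissible_less[OF adm(1) that] by simp
  qed (use sj in simp_all)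
  also have "?g(s := j) = g" using sj(2) by auto
  also have "cst (u j) * \<sigma> (shape_det u L r ?g) - cst (u (Suc j)) * shape_det u L r ?g =
      cst \<delta> * (Mps (D_word n (i # w) ps_one) * Xi)"
    unfolding Cons.IH[OF fits inv_count, symmetric] D_op_Xi[OF sj(3), symmetric] by (simp add: D_word_def sj(4))
  finally show ?case using cst_mult_cancel[of \<delta>] u_ne[of j "Suc j"] sj(3) by simp
qed

end

lemma reduced_word_exists:
  assumes "set w \<subseteq> {0..<n}"
  obtains w' where "reduced_word n w'" "aff_word n w' = aff_word n w"
proof -
  let ?P = "\<lambda>w'. set w' \<subseteq> {0..<n} \<and> aff_word n w' = aff_word n w"
  have "?P w" using assms by simp
  then obtain w' where "?P w'" "\<And>v. ?P v \<Longrightarrow> length w' \<le> length v"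
    using ex_has_least_nat[of ?P w length] by blast
  then show ?thesis using that[of w'] by (simp add: reduced_word_def)
qed

section \<open>Comparison with the matrix of the statement and with xi\<close>

context window
begin

text \<open>The row label \<open>n - L + 1 + p\<close> exceeds \<open>pos p\<close> by the period n,
  so both give the same variable; the recursion for z is then \<open>divdiff_rec\<close> at the two
  end nodes.\<close>

lemma zz_eq_divdiff: "p + d < n \<Longrightarrow> Mps (zz n (n - L + 1 + p) d) = divdiff u {p..p + d}"
proof (induction d arbitrary: p)
  have pos: "ea n (int (n - L + 1 + p)) = ea n (pos p)" for p
  proof -
    have "int (n - L + 1 + p) = pos p + int n" using Lr by (simp add: pos_def of_nat_diff)
    then show ?thesis using ea_eq_iff[OF n] by simp
  qed
  {
    case 0
    show ?case using pos[of p] by (simp add: Om_def bb_def u_def)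
  next
    case (Suc d)
    have ivl: "{p..p + Suc d} = insert p (insert (p + Suc d) {Suc p..p + d})"
      "{p..p + d} = insert p {Suc p..p + d}" "{Suc p..Suc p + d} = insert (p + Suc d) {Suc p..p + d}"
      by auto
    have "{p..p + Suc d} \<subseteq> {..<n}" using Suc.prems by auto
    then have inj: "inj_on u {p..p + Suc d}" by (rule inj_on_subset[OF inj_u])
    have ne: "u (p + Suc d) - u p \<noteq> 0"
      using inj_onD[OF inj_u, of "p + Suc d" p] Suc.prems by auto
    have "cst (u (p + Suc d) - u p) * divdiff u {p..p + Suc d} = divdiff u {p..p + d} - divdiff u {Suc p..Suc p + d}"
      unfolding ivl by (rule divdiff_rec[OF _ _ _ _ inj[unfolded ivl]]) simp_all
    moreover have "Mps (zz n (n - L + 1 + p) (Suc d)) =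
        cst (inverse (u (p + Suc d) - u p)) * (divdiff u {p..p + d} - divdiff u {Suc p..Suc p + d})"
    proof -
      have "inverse (ea n (int (n - L + 1 + p + Suc d))) = u (p + Suc d)"
        "inverse (ea n (int (n - L + 1 + p))) = u p"
        using pos[of "p + Suc d"] pos[of p] by (simp_all add: u_def add.assoc)
      then show ?thesis using Suc.IH[of p] Suc.IH[of "Suc p"] Suc.prems
        by (simp add: Mps_smult Mps_diff)
    qed
    ultimately have "cst (u (p + Suc d) - u p) * Mps (zz n (n - L + 1 + p) (Suc d)) =
        cst (u (p + Suc d) - u p) * divdiff u {p..p + Suc d}"
      using cst_cancel_inverse[OF ne] by simp
    then show ?case using cst_mult_cancel[OF ne] by blast
  }
qed

lemma conj_antimono: "i \<le> j \<Longrightarrow> Defs.conj lam j \<le> Defs.conj lam i"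
  by (induction lam) (auto simp: Defs.conj_def)

lemma M_lam_eq_matrix_entry:
  assumes conj_1: "Defs.conj lam 1 = L" and i: "i < L + r" and q: "q < L + r"
  shows "Mps (M_lam n lam i q) = matrix_entry u L (shape lam) i q"
proof -
  let ?l = "n - L + 1"
  have l: "n - ?l + 1 = L" using L Lr by simp
  have zero: "Mps (ps_const 0) = 0" by (simp add: zero_mps_def)
  note M_lam = M_lam_def[of n lam i q, unfolded Let_def conj_1 l]
  show ?thesis
  proof (cases "i < L")
    case True
    have M: "M_lam n lam i q = z_ent n (?l + i) (?l + q)" unfolding M_lam if_P[OF True] ..
    show ?thesis
    proof (cases "q < i")
      case q_i: True
      then show ?thesis unfolding M using True by (simp add: matrix_entry_def z_ent_def zero)
    next
      case False
      then have "Mps (zz n (?l + i) (?l + q - (?l + i))) = divdiff u {i..q}"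
        using zz_eq_divdiff[of i "q - i"] q Lr by simp
      moreover have "\<not> ?l + q < ?l + i" using False by simp
      ultimately show ?thesis unfolding M matrix_entry_def z_ent_def if_P[OF True] using False by simp
    qed
  next
    case False
    \<comment> \<open>Daggered rows are labelled from 1. With this label the degree m in
      \<open>M_lam\<close> becomes \<open>i - q\<close>.\<close>
    define s where "s = i - L + 1"
    have conj_le: "Defs.conj lam s \<le> L"
      using conj_antimono[of 1 s lam] conj_1 by (simp add: s_def)
    have shape: "shape lam (i - L) = i - Defs.conj lam s" and s: "s + L = i + 1"
      using False by (simp_all add: shape_def s_def)
    have "n + s - (?l + q) = i - q" "?l + q \<le> n + s \<longleftrightarrow> q \<le> i"
      using s Lr L by auto
    then have M: "M_lam n lam i q = (if q \<le> i \<and> i - q \<le> Defs.conj lam s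
        then ps_const ((- 1) ^ (i - q) * (if i - q = 0 then 1 else f_coef n lam (i - q) (i - q) s))
        else ps_const 0)"
      unfolding M_lam if_not_P[OF False] s_def[symmetric] by (simp only:)
    have cond: "q \<le> i \<and> i - q \<le> Defs.conj lam s \<longleftrightarrow> shape lam (i - L) \<le> q \<and> q \<le> i"
      unfolding shape using False conj_le by linarith
    have coef: "(if i - q = 0 then 1 else f_coef n lam (i - q) (i - q) s) = hset (i - q) (u ` {shape lam (i - L)..q})"
      if le: "q \<le> i" "i - q \<le> Defs.conj lam s"
    proof -
      \<comment> \<open>The index \<open>t\<close> of the set corresponds to the window column
        \<open>i - t\<close>, because \<open>s - t\<close> is the position of that column.\<close>
      have "dset n lam (i - q) s = u ` {shape lam (i - L)..q}"
      proof (rule subset_antisym; rule subsetI)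
        fix x assume "x \<in> dset n lam (i - q) s"
        then obtain t where t: "x = inverse (ea n (int s - int t))" "i - q \<le> t" "t \<le> Defs.conj lam s"
          by (auto simp: dset_def)
        have "int s - int t = pos (i - t)" using t conj_le False by (simp add: pos_def s_def of_nat_diff)
        then have "x = u (i - t)" using t(1) by (simp only: u_def)
        moreover have "i - t \<in> {shape lam (i - L)..q}" using t conj_le le False unfolding shape by auto
        ultimately show "x \<in> u ` {shape lam (i - L)..q}" by blast
      next
        fix x assume "x \<in> u ` {shape lam (i - L)..q}"
        then obtain k where k: "x = u k" "shape lam (i - L) \<le> k" "k \<le> q" by auto
        have "int s - int (i - k) = pos k"
          using k le False by (simp add: pos_def s_def of_nat_diff)
        then have "x = inverse (ea n (int s - int (i - k)))" using k(1) by (simp only: u_def)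
        moreover have "i - q \<le> i - k" "i - k \<le> Defs.conj lam s"
          using k conj_le False unfolding shape by auto
        ultimately show "x \<in> dset n lam (i - q) s" unfolding dset_def by blast
      qed
      then show ?thesis by (simp add: f_coef_def hset_0)
    qed
    show ?thesis
    proof (cases "q \<le> i \<and> i - q \<le> Defs.conj lam s")
      case True
      have "M_lam n lam i q = ps_const ((- 1) ^ (i - q) * hset (i - q) (u ` {shape lam (i - L)..q}))"
        unfolding M if_P[OF True] coef[OF conjunct1[OF True] conjunct2[OF True]] ..
      moreover have "shape lam (i - L) \<le> q \<and> q \<le> i" using True cond by blast
      ultimately show ?thesis unfolding matrix_entry_def if_not_P[OF False] by (simp add: cst_def)
    next
      case outside: False
      have "M_lam n lam i q = ps_const 0" using outside unfolding M by (rule if_not_P)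
      moreover have "\<not> (shape lam (i - L) \<le> q \<and> q \<le> i)" using outside cond by blast
      then have "matrix_entry u L (shape lam) i q = 0"
        unfolding matrix_entry_def if_not_P[OF False] by (rule if_not_P)
      ultimately show ?thesis by (simp only: zero)
    qed
  qed
qed

lemma Mps_xi:
  assumes "Defs.conj lam 1 = L"
  shows "Mps (xi n lam) = Xi"
proof -
  have "Defs.conj lam (Suc 0) = L" using assms by simp
  then have "Mps (xi n lam) = prod_list (map (\<lambda>i. Om (bb n (1 - int i))) [1..<L + 1])"
    by (simp add: xi_def Mps_prodl comp_def Om_def del: upt_Suc)
  also have "\<dots> = (\<Prod>i\<in>{1..<L + 1}. Om (bb n (1 - int i)))"
    by (subst prod.distinct_set_conv_list[symmetric]) (simp_all del: upt_Suc)
  also have "\<dots> = (\<Prod>k<L. Om (1 - u k))"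
    \<comment> \<open>The subscript \<open>1 - i\<close> is the position of column
      \<open>L - i\<close>.\<close>
    by (rule prod.reindex_bij_witness[where i = "\<lambda>k. L - k" and j = "\<lambda>i. L - i"])
       (auto simp: bb_def u_def pos_def of_nat_diff)
  finally show ?thesis by (simp add: Xi_def)
qed

end

theorem theorem5p1:
  fixes n :: nat and lam :: "nat list"
  assumes "2 \<le> n"
    and "is_partition lam" and "k_small n lam" and "lam \<noteq> []"
  shows "g_tilde n lam =
           ps_mult (ps_det (n - (n - conj lam 1 + 1) + 1 + hd lam) (M_lam n lam))
                   (ps_inv (xi n lam))"
proof -
  define L r where "L = length lam" and "r = hd lam"
  have part: "\<forall>x\<in>set lam. 0 < x" "sorted_wrt (\<ge>) lam"
    using assms(2) by (simp_all add: is_partition_def)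
  have Lr: "1 \<le> L" "L + r \<le> n"
    using assms(3,4) by (auto simp: k_small_def L_def r_def Suc_le_eq add.commute)
  interpret window n L r by unfold_locales (use assms(1) Lr in auto)
  have le_r: "\<forall>x\<in>set lam. x \<le> r"
    using part(2) assms(4) by (cases lam) (auto simp: r_def)
  have conj_1: "conj lam 1 = L"
    unfolding L_def by (rule conj_full) (use part(1) in \<open>auto simp: Suc_le_eq\<close>)
  have box: "fits (box_word n lam) (shape lam)" "int (length (box_word n lam)) = inv_count n (shape_charge (shape lam))"
    using fits_box_word[OF part(2) eq_refl[OF L_def[symmetric]] le_r] by blast+
  then have letters: "set (box_word n lam) \<subseteq> {0..<n}" by (simp add: fits_def)
  \<comment> \<open>Only minimality of this word and the permutation it represents are known; its
    charges come from the box word through \<open>level_cong\<close>.\<close>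
  define w where "w = (SOME w. reduced_word n w \<and> aff_word n w = x_lambda n lam)"
  have w: "reduced_word n w" "aff_word n w = aff_word n (box_word n lam)"
    using reduced_word_exists[OF letters] someI_ex[of "\<lambda>w. reduced_word n w \<and> aff_word n w = x_lambda n lam"]
    unfolding w_def x_lambda_def by metis+
  have w_letters: "set w \<subseteq> {0..<n}" using w(1) by (simp add: reduced_word_def)
  have "fits w (shape lam)"
    using box(1) level_cong[OF assms(1) w_letters letters w(2)] w_letters
    by (simp add: fits_def charge_def)
  \<comment> \<open>The length of the box word is the inversion count, so this is the length bound
    required for the induction along the word.\<close>
  moreover have "length w \<le> length (box_word n lam)" 
    using w(1) letters w(2)[symmetric] unfolding reduced_word_def by blast
  ultimately have main: "Mps (g_tilde n lam) * Xi = shape_det u L r (shape lam)"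
    unfolding g_tilde_def g_tilde_elem_def D_elem_def w_def[symmetric]
    using box(2) by (intro D_word_eq_shape_det) simp_all
  have det: "Mps (ps_det (L + r) (M_lam n lam)) = shape_det u L r (shape lam)"
    unfolding Mps_det shape_det_def
    by (rule arg_cong[of _ _ det], rule eq_matI) (simp_all add: M_lam_eq_matrix_entry[OF conj_1])
  obtain V where V: "V * Xi = 1" using Xi_unit by blast
  have size: "n - (n - conj lam 1 + 1) + 1 + hd lam = L + r"
    unfolding conj_1 r_def[symmetric] using Lr L by simp
  have "Mps (g_tilde n lam) = Mps (g_tilde n lam) * Xi * V"
    using V by (simp add: mult.assoc mult.commute[of Xi])
  also have "\<dots> = Mps (ps_det (L + r) (M_lam n lam)) * Mps (ps_inv (xi n lam))"
    using main det Mps_inv[of V "xi n lam"] V by (simp add: Mps_xi[OF conj_1])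
  finally show ?thesis
    unfolding size Mps_mult[symmetric] Mps_eq_iff .
qed

end
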